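(* Equivalence of residual nominal automata is undecidable: there is no algorithm which, given two residual nominal automata $\mathcal{A}_1,\mathcal{A}_2$ over the same orbit-finite alphabet, decides whether $\mathcal{L}(\mathcal{A}_1)=\mathcal{L}(\mathcal{A}_2)$.
   Context: Nominal sets: $\mathbb{A}$ is a countably infinite set of atoms and $\mathrm{Perm}(\mathbb{A})$ is the group of finite permutations of $\mathbb{A}$. A nominal set is a set with a $\mathrm{Perm}(\mathbb{A})$-action in which every element $x$ has a finite support (a finite $A\subseteq\mathbb{A}$ such that $\pi x=x$ whenever $\pi$ fixes $A$ pointwise). A subset $U$ is equivariant if $\pi U=U$ for all $\pi$. A nominal set is orbit-finite if it is a finite union of orbits. A nominal automaton consists of an orbit-finite nominal alphabet $\Sigma$, an orbit-finite nominal set $Q$ of states, and equivariant subsets $I\subseteq Q$ (initial), $F\subseteq Q$ (final), $\delta\subseteq Q\times\Sigma\times Q$ (transitions), with the usual (nondeterministic) acceptance; $[\![q]\!]$ is the language accepted from $q$. It is residual if for each $q\in Q$ there is a word $w\in\Sigma^*$ with $[\![q]\!]=w^{-1}\mathcal{L}(\mathcal{A})=\{v\mid wv\in\mathcal{L}(\mathcal{A})\}$. Nominal automata are given as input by a standard finite representation of orbit-finite sets and equivariant relations. Inputs are promised to be residual. It is known (prior work) that universality ($\mathcal{L}(\mathcal{A})=\Sigma^*$?) is undecidable for nondeterministic nominal automata. *)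

theory Defs
  imports "HOL-Library.Nat_Bijection" "HOL-Combinatorics.Perm"
begin

section \<open>Nominal sets\<close>

text \<open>The type \<open>atom perm\<close> is the group of finite permutations of the atoms.\<close>

type_synonym atom = nat

definition supports :: "(atom perm \<Rightarrow> 'x \<Rightarrow> 'x) \<Rightarrow> atom set \<Rightarrow> 'x \<Rightarrow> bool" where
  "supports act S x \<longleftrightarrow> (\<forall>\<pi>. (\<forall>a\<in>S. apply \<pi> a = a) \<longrightarrow> act \<pi> x = x)"

definition nominal_set :: "(atom perm \<Rightarrow> 'x \<Rightarrow> 'x) \<Rightarrow> 'x set \<Rightarrow> bool" where
  "nominal_set act X \<longleftrightarrow>
     (\<forall>\<pi>. \<forall>x\<in>X. act \<pi> x \<in> X) \<and>
     (\<forall>x\<in>X. act 1 x = x) \<and>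
     (\<forall>\<pi> \<sigma>. \<forall>x\<in>X. act (\<pi> * \<sigma>) x = act \<pi> (act \<sigma> x)) \<and>
     (\<forall>x\<in>X. \<exists>S. finite S \<and> supports act S x)"

definition orbit_of :: "(atom perm \<Rightarrow> 'x \<Rightarrow> 'x) \<Rightarrow> 'x \<Rightarrow> 'x set" where
  "orbit_of act x = range (\<lambda>\<pi>. act \<pi> x)"

definition orbit_finite :: "(atom perm \<Rightarrow> 'x \<Rightarrow> 'x) \<Rightarrow> 'x set \<Rightarrow> bool" where
  "orbit_finite act X \<longleftrightarrow> nominal_set act X \<and> finite (orbit_of act ` X)"

definition equivariant :: "(atom perm \<Rightarrow> 'x \<Rightarrow> 'x) \<Rightarrow> 'x set \<Rightarrow> bool" where
  "equivariant act U \<longleftrightarrow> (\<forall>\<pi>. act \<pi> ` U = U)"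


section \<open>Nominal automata\<close>

record ('q, 's) automaton =
  alphabet :: "'s set"
  letter_act :: "atom perm \<Rightarrow> 's \<Rightarrow> 's"
  states :: "'q set"
  state_act :: "atom perm \<Rightarrow> 'q \<Rightarrow> 'q"
  initial :: "'q set"
  final :: "'q set"
  transitions :: "('q \<times> 's \<times> 'q) set"

definition transition_act ::
  "('q, 's) automaton \<Rightarrow> atom perm \<Rightarrow> 'q \<times> 's \<times> 'q \<Rightarrow> 'q \<times> 's \<times> 'q" where
  "transition_act A \<pi> = (\<lambda>(p, a, q). (state_act A \<pi> p, letter_act A \<pi> a, state_act A \<pi> q))"

definition nominal_automaton :: "('q, 's) automaton \<Rightarrow> bool" where
  "nominal_automaton A \<longleftrightarrow>
     orbit_finite (letter_act A) (alphabet A) \<and>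
     orbit_finite (state_act A) (states A) \<and>
     initial A \<subseteq> states A \<and> equivariant (state_act A) (initial A) \<and>
     final A \<subseteq> states A \<and> equivariant (state_act A) (final A) \<and>
     transitions A \<subseteq> states A \<times> alphabet A \<times> states A \<and>
     equivariant (transition_act A) (transitions A)"

primrec accepts :: "('q, 's) automaton \<Rightarrow> 'q \<Rightarrow> 's list \<Rightarrow> bool" where
  "accepts A q [] \<longleftrightarrow> q \<in> final A"
| "accepts A q (a # w) \<longleftrightarrow> (\<exists>q'. (q, a, q') \<in> transitions A \<and> accepts A q' w)"

definition state_language :: "('q, 's) automaton \<Rightarrow> 'q \<Rightarrow> 's list set" where
  "state_language A q = {w \<in> lists (alphabet A). accepts A q w}"

definition language :: "('q, 's) automaton \<Rightarrow> 's list set" where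
  "language A = (\<Union>q\<in>initial A. state_language A q)"

definition residual_automaton :: "('q, 's) automaton \<Rightarrow> bool" where
  "residual_automaton A \<longleftrightarrow> nominal_automaton A \<and>
     (\<forall>q\<in>states A. \<exists>w\<in>lists (alphabet A). state_language A q = {v. w @ v \<in> language A})"


section \<open>Finite presentations\<close>

text \<open>
  Every single-orbit nominal set is isomorphic to a quotient of the set of \<open>k\<close>-tuples of
  distinct atoms by a group \<open>G\<close> of permutations of the \<open>k\<close> positions.  An orbit is therefore
  presented by \<open>(k, G)\<close>, where \<open>G\<close> enumerates the group and a permutation \<open>g\<close> is given by the
  list \<open>[g 0, \<dots>, g (k - 1)]\<close> of its values; an orbit-finite set is presented by a list of orbits.
  The pair \<open>(i, t)\<close> presents the element of the \<open>i\<close>-th orbit that is the class of the tuple \<open>t\<close>.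
\<close>

type_synonym orbit_pres = "nat \<times> nat list list"
type_synonym set_pres = "orbit_pres list"
type_synonym elem_pres = "nat \<times> atom list"

definition wf_orbit :: "orbit_pres \<Rightarrow> bool" where
  "wf_orbit = (\<lambda>(k, G).
     (\<forall>g\<in>set G. length g = k \<and> distinct g \<and> set g = {..<k}) \<and>
     [0..<k] \<in> set G \<and>
     (\<forall>g\<in>set G. \<forall>h\<in>set G. map ((!) g) h \<in> set G))"

definition wf_elem :: "set_pres \<Rightarrow> elem_pres \<Rightarrow> bool" where
  "wf_elem X = (\<lambda>(i, t). i < length X \<and> length t = fst (X ! i) \<and> distinct t)"

definition elem :: "set_pres \<Rightarrow> elem_pres \<Rightarrow> nat \<times> atom list set" where
  "elem X = (\<lambda>(i, t). (i, {map ((!) t) g | g. g \<in> set (snd (X ! i))}))"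

definition carrier_of :: "set_pres \<Rightarrow> (nat \<times> atom list set) set" where
  "carrier_of X = {elem X e | e. wf_elem X e}"

definition elem_act :: "atom perm \<Rightarrow> nat \<times> atom list set \<Rightarrow> nat \<times> atom list set" where
  "elem_act \<pi> = (\<lambda>(i, C). (i, map (apply \<pi>) ` C))"

text \<open>
  The subsets \<open>I\<close>, \<open>F\<close> and the transition relation are presented by lists that contain
  a representative of each of their (finitely many) orbits.
\<close>

record automaton_pres =
  alphabet_pres :: set_pres
  states_pres :: set_pres
  initial_pres :: "elem_pres list"
  final_pres :: "elem_pres list"
  transitions_pres :: "(elem_pres \<times> elem_pres \<times> elem_pres) list"

definition wf_pres :: "automaton_pres \<Rightarrow> bool" where
  "wf_pres P \<longleftrightarrow>
     (\<forall>r\<in>set (alphabet_pres P). wf_orbit r) \<and>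
     (\<forall>r\<in>set (states_pres P). wf_orbit r) \<and>
     (\<forall>e\<in>set (initial_pres P). wf_elem (states_pres P) e) \<and>
     (\<forall>e\<in>set (final_pres P). wf_elem (states_pres P) e) \<and>
     (\<forall>(p, a, q)\<in>set (transitions_pres P).
        wf_elem (states_pres P) p \<and> wf_elem (alphabet_pres P) a \<and> wf_elem (states_pres P) q)"

definition automaton_of ::
  "automaton_pres \<Rightarrow> (nat \<times> atom list set, nat \<times> atom list set) automaton" where
  "automaton_of P =
     (let st = elem (states_pres P); lt = elem (alphabet_pres P) in
      \<lparr>alphabet = carrier_of (alphabet_pres P),
       letter_act = elem_act,
       states = carrier_of (states_pres P),
       state_act = elem_act,
       initial = {elem_act \<pi> (st e) | \<pi> e. e \<in> set (initial_pres P)},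
       final = {elem_act \<pi> (st e) | \<pi> e. e \<in> set (final_pres P)},
       transitions = {(elem_act \<pi> (st p), elem_act \<pi> (lt a), elem_act \<pi> (st q)) | \<pi> p a q.
                       (p, a, q) \<in> set (transitions_pres P)}\<rparr>)"

lemma elem_act_one: "elem_act 1 x = x"
  by (cases x) (simp add: elem_act_def)

lemma elem_act_mult: "elem_act (\<pi> * \<sigma>) x = elem_act \<pi> (elem_act \<sigma> x)"
  by (cases x) (simp add: elem_act_def apply_times image_image)

lemma elem_act_elem:
  assumes "\<forall>r\<in>set X. wf_orbit r" and "wf_elem X (i, t)"
  shows "elem_act \<pi> (elem X (i, t)) = elem X (i, map (apply \<pi>) t)"
proof -
  have i: "i < length X" "length t = fst (X ! i)"
    using assms(2) by (auto simp: wf_elem_def)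
  with assms(1) have "wf_orbit (X ! i)" by auto
  then have "map (apply \<pi>) (map ((!) t) g) = map ((!) (map (apply \<pi>) t)) g"
    if "g \<in> set (snd (X ! i))" for g
    using that i by (cases "X ! i") (auto simp: wf_orbit_def)
  then have "map (apply \<pi>) ` (\<lambda>g. map ((!) t) g) ` set (snd (X ! i)) =
      (\<lambda>g. map ((!) (map (apply \<pi>) t)) g) ` set (snd (X ! i))"
    unfolding image_image by (intro image_cong refl) blast
  then show ?thesis
    by (simp add: elem_act_def elem_def setcompr_eq_image)
qed

lemma wf_elem_map:
  "wf_elem X (i, t) \<Longrightarrow> wf_elem X (i, map (apply \<pi>) t)"
  by (auto simp: wf_elem_def distinct_map inj_on_def apply_inj)

lemma elem_act_carrier:
  assumes "\<forall>r\<in>set X. wf_orbit r" and "wf_elem X e"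
  shows "elem_act \<pi> (elem X e) \<in> carrier_of X"
proof -
  obtain i t where "e = (i, t)" by (cases e)
  then have "elem_act \<pi> (elem X e) = elem X (i, map (apply \<pi>) t)"
    "wf_elem X (i, map (apply \<pi>) t)"
    using assms elem_act_elem wf_elem_map by auto
  then show ?thesis unfolding carrier_of_def by blast
qed

lemma perm_extend:
  assumes "distinct s" "distinct t" "length s = length t"
  shows "\<exists>\<pi>. map (apply \<pi>) s = (t :: 'a list)"
  using assms
proof (induction s t rule: list_induct2')
  case (4 x s y t)
  then obtain \<pi> where \<pi>: "map (apply \<pi>) s = t" by auto
  let ?z = "apply \<pi> x"
  have z: "?z \<notin> set t"
    using 4 \<pi> by (auto simp: apply_inj)
  have sw: "apply (swap ?z y) a = (if a = ?z then y else if a = y then ?z else a)" for a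
    by transfer (auto simp: Transposition.transpose_def)
  have "map (apply (swap ?z y)) t = t"
    using z 4 by (intro map_idI) (auto simp: sw)
  then have "map (apply (swap ?z y * \<pi>)) (x # s) = y # t"
    by (simp add: apply_times sw flip: \<pi>)
  then show ?case by (rule exI)
qed auto

lemma orbit_of_elem_act: "orbit_of elem_act (elem_act \<pi> x) \<subseteq> orbit_of elem_act x"
  by (auto simp: orbit_of_def simp flip: elem_act_mult)

lemma orbit_finite_carrier_of:
  assumes wf: "\<forall>r\<in>set X. wf_orbit r"
  shows "orbit_finite elem_act (carrier_of X)"
proof -
  have "\<exists>S. finite S \<and> supports elem_act S x" if x: "x \<in> carrier_of X" for x
  proof -
    from x obtain i t where t: "x = elem X (i, t)" "wf_elem X (i, t)"
      by (auto simp: carrier_of_def)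
    have "supports elem_act (set t) x"
      using elem_act_elem[OF wf t(2)] by (auto simp: supports_def t(1) map_idI)
    then show ?thesis by blast
  qed
  moreover have "elem_act \<pi> x \<in> carrier_of X" if "x \<in> carrier_of X" for \<pi> x
    using that elem_act_carrier[OF wf] by (auto simp: carrier_of_def[of X])
  ultimately have nom: "nominal_set elem_act (carrier_of X)"
    by (simp add: nominal_set_def elem_act_one elem_act_mult)
  have "orbit_of elem_act x \<in> (\<lambda>i. orbit_of elem_act (elem X (i, [0..<fst (X ! i)]))) ` {..<length X}"
    if x: "x \<in> carrier_of X" for x
  proof -
    from x obtain i t where t: "x = elem X (i, t)" "wf_elem X (i, t)"
      by (auto simp: carrier_of_def)
    let ?u = "[0..<fst (X ! i)]"
    have i: "i < length X" and u: "wf_elem X (i, ?u)"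
      using t(2) by (auto simp: wf_elem_def)
    obtain \<pi> \<sigma> where "map (apply \<pi>) ?u = t" "map (apply \<sigma>) t = ?u"
      using perm_extend[of ?u t] perm_extend[of t ?u] t(2) by (auto simp: wf_elem_def)
    then have "x = elem_act \<pi> (elem X (i, ?u))" "elem X (i, ?u) = elem_act \<sigma> x"
      using elem_act_elem[OF wf u] elem_act_elem[OF wf t(2)] t(1) by auto
    then have "orbit_of elem_act x = orbit_of elem_act (elem X (i, ?u))"
      using orbit_of_elem_act by (metis subset_antisym)
    with i show ?thesis by blast
  qed
  then have "finite (orbit_of elem_act ` carrier_of X)"
    by (intro finite_subset[OF _ finite_imageI[OF finite_lessThan]]) blast
  with nom show ?thesis by (simp add: orbit_finite_def)
qed

lemma elem_act_inverse: "elem_act \<pi> (elem_act (inverse \<pi>) x) = x"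
  by (simp add: elem_act_mult[symmetric] elem_act_one perm_eq_iff)

lemma equivariantI:
  assumes "\<And>\<pi> x. x \<in> U \<Longrightarrow> act \<pi> x \<in> U" and "\<And>\<pi> x. act \<pi> (act (inverse \<pi>) x) = x"
  shows "equivariant act U"
  unfolding equivariant_def
proof (intro allI equalityI subsetI)
  fix \<pi> x assume "x \<in> U"
  then show "x \<in> act \<pi> ` U"
    using assms by (intro image_eqI[where x = "act (inverse \<pi>) x"]) simp_all
qed (use assms(1) in blast)

lemma equivariant_generated:
  "equivariant elem_act {elem_act \<pi> (f e) | \<pi> e. e \<in> E}"
proof (rule equivariantI)
  fix \<pi> x assume "x \<in> {elem_act \<pi> (f e) | \<pi> e. e \<in> E}"
  then obtain \<sigma> e where "e \<in> E" "elem_act \<pi> x = elem_act (\<pi> * \<sigma>) (f e)"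
    by (auto simp only: mem_Collect_eq elem_act_mult)
  then show "elem_act \<pi> x \<in> {elem_act \<pi> (f e) | \<pi> e. e \<in> E}"
    by blast
qed (rule elem_act_inverse)

lemma nominal_automaton_of:
  assumes "wf_pres P"
  shows "nominal_automaton (automaton_of P)"
proof -
  let ?T = "transitions (automaton_of P)"
  have T: "?T = {(elem_act \<pi> (elem (states_pres P) p), elem_act \<pi> (elem (alphabet_pres P) a),
                  elem_act \<pi> (elem (states_pres P) q)) | \<pi> p a q.
                  (p, a, q) \<in> set (transitions_pres P)}"
    by (simp add: automaton_of_def Let_def)
  have wf: "\<forall>r\<in>set (alphabet_pres P). wf_orbit r" "\<forall>r\<in>set (states_pres P). wf_orbit r"
    using assms by (auto simp: wf_pres_def)
  have act: "transition_act (automaton_of P) \<pi> (p, a, q) = (elem_act \<pi> p, elem_act \<pi> a, elem_act \<pi> q)"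
    for \<pi> p a q
    by (simp add: transition_act_def automaton_of_def Let_def)
  have closed: "transition_act (automaton_of P) \<pi> t \<in> ?T" if t: "t \<in> ?T" for \<pi> t
  proof -
    from t obtain \<sigma> p a q where e: "(p, a, q) \<in> set (transitions_pres P)"
      "t = (elem_act \<sigma> (elem (states_pres P) p), elem_act \<sigma> (elem (alphabet_pres P) a),
            elem_act \<sigma> (elem (states_pres P) q))"
      unfolding T by blast
    then have "transition_act (automaton_of P) \<pi> t =
      (elem_act (\<pi> * \<sigma>) (elem (states_pres P) p), elem_act (\<pi> * \<sigma>) (elem (alphabet_pres P) a),
            elem_act (\<pi> * \<sigma>) (elem (states_pres P) q))"
      by (simp add: act elem_act_mult)
    with e(1) show ?thesis unfolding T by blast
  qed
  have inv: "transition_act (automaton_of P) \<pi> (transition_act (automaton_of P) (inverse \<pi>) t) = t"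
    for \<pi> t
    by (cases t) (simp add: act elem_act_inverse)
  have eqT: "equivariant (transition_act (automaton_of P)) ?T"
    using closed inv by (rule equivariantI)
  have "?T \<subseteq> carrier_of (states_pres P) \<times> carrier_of (alphabet_pres P) \<times> carrier_of (states_pres P)"
  proof
    fix t assume "t \<in> ?T"
    then obtain \<pi> p a q where e: "(p, a, q) \<in> set (transitions_pres P)"
      and t: "t = (elem_act \<pi> (elem (states_pres P) p), elem_act \<pi> (elem (alphabet_pres P) a),
                elem_act \<pi> (elem (states_pres P) q))"
      unfolding T by blast
    from e assms have "wf_elem (states_pres P) p" "wf_elem (alphabet_pres P) a"
      "wf_elem (states_pres P) q"
      unfolding wf_pres_def by blast+
    with t show "t \<in> carrier_of (states_pres P) \<times> carrier_of (alphabet_pres P) \<times> carrier_of (states_pres P)"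
      using elem_act_carrier wf by blast
  qed
  moreover have "{elem_act \<pi> (elem (states_pres P) e) | \<pi> e. e \<in> E} \<subseteq> carrier_of (states_pres P)"
    if "\<forall>e\<in>E. wf_elem (states_pres P) e" for E
    using that elem_act_carrier[OF wf(2)] by blast
  then have "initial (automaton_of P) \<subseteq> carrier_of (states_pres P)"
    "final (automaton_of P) \<subseteq> carrier_of (states_pres P)"
    using assms by (simp_all add: automaton_of_def Let_def wf_pres_def)
  moreover have "equivariant elem_act (initial (automaton_of P))"
    "equivariant elem_act (final (automaton_of P))"
    by (simp_all add: automaton_of_def Let_def equivariant_generated del: split_paired_Ex)
  moreover have "alphabet (automaton_of P) = carrier_of (alphabet_pres P)"
    "letter_act (automaton_of P) = elem_act"
    "states (automaton_of P) = carrier_of (states_pres P)"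
    "state_act (automaton_of P) = elem_act"
    by (simp_all add: automaton_of_def Let_def)
  ultimately show ?thesis
    using eqT orbit_finite_carrier_of[OF wf(1)] orbit_finite_carrier_of[OF wf(2)]
    by (simp add: nominal_automaton_def)
qed


section \<open>Encoding of presentations as natural numbers\<close>

definition encode_set :: "set_pres \<Rightarrow> nat" where
  "encode_set X =
     list_encode (map (\<lambda>(k, G). prod_encode (k, list_encode (map list_encode G))) X)"

definition encode_elem :: "elem_pres \<Rightarrow> nat" where
  "encode_elem = (\<lambda>(i, t). prod_encode (i, list_encode t))"

definition encode_transition :: "elem_pres \<times> elem_pres \<times> elem_pres \<Rightarrow> nat" where
  "encode_transition = (\<lambda>(p, a, q). list_encode [encode_elem p, encode_elem a, encode_elem q])"

definition encode_automaton :: "automaton_pres \<Rightarrow> nat" where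
  "encode_automaton P = list_encode
     [encode_set (alphabet_pres P),
      encode_set (states_pres P),
      list_encode (map encode_elem (initial_pres P)),
      list_encode (map encode_elem (final_pres P)),
      list_encode (map encode_transition (transitions_pres P))]"

definition encode_input :: "automaton_pres \<times> automaton_pres \<Rightarrow> nat" where
  "encode_input = (\<lambda>(P1, P2). prod_encode (encode_automaton P1, encode_automaton P2))"

lemma inj_list_encode_map: "inj f \<Longrightarrow> inj (\<lambda>xs. list_encode (map f xs))"
  by (auto simp: inj_def list_encode_eq inj_map_eq_map)

lemma inj_encode_set: "inj encode_set"
proof -
  have "inj (\<lambda>(k, G). prod_encode (k :: nat, list_encode (map list_encode G)))"
    using inj_list_encode_map[OF inj_list_encode] by (auto simp: inj_def)
  from inj_list_encode_map[OF this] show ?thesis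
    by (simp add: encode_set_def[abs_def])
qed

lemma inj_encode_elem: "inj encode_elem"
  by (auto simp: inj_def encode_elem_def list_encode_eq)

lemma inj_encode_transition: "inj encode_transition"
  using inj_encode_elem
  by (auto simp: inj_def encode_transition_def list_encode_eq simp del: list_encode.simps)

lemma inj_encode_automaton: "inj encode_automaton"
  using inj_encode_set inj_list_encode_map[OF inj_encode_elem]
    inj_list_encode_map[OF inj_encode_transition]
  by (auto simp: inj_def encode_automaton_def list_encode_eq simp del: list_encode.simps)

lemma inj_encode_input: "inj encode_input"
  using inj_encode_automaton by (auto simp: inj_def encode_input_def)


section \<open>Algorithms\<close>

text \<open>
  Algorithms are partial recursive functions in the sense of Kleene; \<open>None\<close> means divergence.
  Arities are not tracked: a scheme applied to a list of unsuitable length is undefined.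
\<close>

datatype recf = Zero | Succ | Proj nat | Comp recf "recf list" | PrimRec recf recf | Mu recf

fun rec_eval :: "recf \<Rightarrow> nat list \<Rightarrow> nat option" where
  "rec_eval Zero xs = Some 0"
| "rec_eval Succ xs = (case xs of [x] \<Rightarrow> Some (Suc x) | _ \<Rightarrow> None)"
| "rec_eval (Proj i) xs = (if i < length xs then Some (xs ! i) else None)"
| "rec_eval (Comp f gs) xs =
     Option.bind (those (map (\<lambda>g. rec_eval g xs) gs)) (\<lambda>ys. rec_eval f ys)"
| "rec_eval (PrimRec f g) xs =
     (case xs of
        [] \<Rightarrow> None
      | n # ys \<Rightarrow>
          rec_nat (rec_eval f ys) (\<lambda>m r. Option.bind r (\<lambda>y. rec_eval g (m # y # ys))) n)"
| "rec_eval (Mu f) xs =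
     (let zero_at = (\<lambda>n. rec_eval f (n # xs) = Some 0 \<and>
                         (\<forall>m<n. \<exists>y. rec_eval f (m # xs) = Some (Suc y)))
      in if \<exists>n. zero_at n then Some (THE n. zero_at n) else None)"

text \<open>
  Decidability of the problem \<open>Y\<close> under the promise that the input lies in \<open>D\<close>: the algorithm
  has to terminate with the correct answer on inputs in \<open>D\<close> and is unconstrained elsewhere.
\<close>

definition decidable_under_promise :: "('i \<Rightarrow> nat) \<Rightarrow> 'i set \<Rightarrow> 'i set \<Rightarrow> bool" where
  "decidable_under_promise enc D Y \<longleftrightarrow>
     (\<exists>f. \<forall>x\<in>D. rec_eval f [enc x] = Some (if x \<in> Y then 1 else 0))"

end

theory Submission
  imports Defs
begin

text \<open>
  Halting of partial recursive functions is reduced to the equivalence problem.  A function is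
  computed by a counter program, presented as a regular language of words over increments,
  decrements and zero tests; it halts iff one of these words can be executed.  In a data word
  every instruction carries an atom, and a counter is the set of atoms that were inserted and not
  removed.  A nominal automaton can then accept all words that are \<^emph>\<open>not\<close> executable words of the
  program: control errors are found by the complement of a finite automaton, and data errors by
  guessing one atom and one counter and following whether the atom belongs to the counter.  So the
  automaton is universal iff the program diverges.

  To make it residual, a fresh initial state gets one transition to every state \<open>q\<close>, labelled with
  a letter that is used for \<open>q\<close> only; so the language of \<open>q\<close> is a derivative of the whole
  language.  A further letter \<open>Hash\<close> leads to the initial states of the original automaton; in the
  second automaton it also leads to a state that accepts everything.  The two automata
  are equivalent iff the original one is universal.

  No universal function is needed for the diagonal argument: the input \<open>n\<close> enters the presentation
  through \<open>n\<close> additional blocks of states, and \<open>n\<close> is chosen as the code of the remaining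
  transitions, so that the presentation is a computable function of \<open>n\<close>.
\<close>

section \<open>Regular languages\<close>

definition lquot :: "'a list \<Rightarrow> 'a list set \<Rightarrow> 'a list set" where
  "lquot w L = {v. w @ v \<in> L}"

text \<open>The Myhill-Nerode form: the left quotients are the states of the minimal deterministic
  automaton and later become the \<open>Control\<close> states. The second conjunct confines a
  language over the infinite type \<open>instr\<close> to finitely many letters.\<close>

definition regular :: "'a list set \<Rightarrow> bool" where
  "regular L \<longleftrightarrow> finite (range (\<lambda>w. lquot w L)) \<and> (\<exists>A. finite A \<and> L \<subseteq> lists A)"

definition conc :: "'a list set \<Rightarrow> 'a list set \<Rightarrow> 'a list set" where
  "conc L K = {u @ v | u v. u \<in> L \<and> v \<in> K}"

inductive_set star :: "'a list set \<Rightarrow> 'a list set" for L where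
  Nil: "[] \<in> star L"
| append: "u \<in> L \<Longrightarrow> v \<in> star L \<Longrightarrow> u @ v \<in> star L"

lemma lquot_lquot: "lquot v (lquot u L) = lquot (u @ v) L"
  by (simp add: lquot_def)

lemma regular_empty: "regular {}"
  by (auto simp: regular_def lquot_def)

lemma regular_Nil: "regular {[]}"
proof -
  have "range (\<lambda>w. lquot w {[]}) \<subseteq> {{}, {[] :: 'a list}}"
    by (auto simp: lquot_def)
  then show ?thesis
    unfolding regular_def by (auto intro: finite_subset)
qed

lemma regular_single: "regular {[a]}"
proof -
  have "lquot w {[a]} \<in> {{}, {[]}, {[a]}}" for w
    by (cases w) (auto simp: lquot_def)
  then have "range (\<lambda>w. lquot w {[a]}) \<subseteq> {{}, {[]}, {[a]}}"
    by blast
  then have "finite (range (\<lambda>w. lquot w {[a]}))"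
    by (rule finite_subset) simp
  moreover have "finite {a}" "{[a]} \<subseteq> lists {a}"
    by simp_all
  ultimately show ?thesis
    unfolding regular_def by blast
qed

text \<open>In a factorisation of \<open>w @ x\<close> the cut falls either at or after the end of
  \<open>w\<close>, which leaves a quotient of \<open>L\<close>, or inside \<open>w\<close>, which
  leaves a quotient of \<open>K\<close>.\<close>

lemma lquot_conc:
  "lquot w (conc L K) = conc (lquot w L) K \<union> \<Union>{lquot v K | u v. w = u @ v \<and> u \<in> L}"
proof (intro set_eqI iffI)
  fix x assume "x \<in> lquot w (conc L K)"
  then obtain p q where pq: "w @ x = p @ q" "p \<in> L" "q \<in> K"
    by (auto simp: lquot_def conc_def)
  then consider us where "w = p @ us" "q = us @ x" | us where "p = w @ us" "x = us @ q"
    by (auto simp: append_eq_append_conv2)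
  then show "x \<in> conc (lquot w L) K \<union> \<Union>{lquot v K | u v. w = u @ v \<and> u \<in> L}"
  proof cases
    case 1
    then show ?thesis using pq by (auto simp: lquot_def)
  next
    case 2
    then show ?thesis using pq by (auto simp: lquot_def conc_def)
  qed
next
  fix x assume "x \<in> conc (lquot w L) K \<union> \<Union>{lquot v K | u v. w = u @ v \<and> u \<in> L}"
  then consider p q where "x = p @ q" "w @ p \<in> L" "q \<in> K"
    | u v where "w = u @ v" "u \<in> L" "v @ x \<in> K"
    by (auto simp: lquot_def conc_def)
  then have "\<exists>p q. w @ x = p @ q \<and> p \<in> L \<and> q \<in> K"
    by cases (metis append.assoc)+
  then show "x \<in> lquot w (conc L K)"
    by (simp add: lquot_def conc_def)
qed

text \<open>By \<open>lquot_conc\<close> a quotient is determined by one quotient of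
  \<open>L\<close> and a set of quotients of \<open>K\<close>; there are finitely many such
  pairs.\<close>

lemma regular_conc:
  assumes "regular L" "regular K"
  shows "regular (conc L K)"
proof -
  let ?S = "range (\<lambda>w. lquot w L) \<times> Pow (range (\<lambda>w. lquot w K))"
  have "lquot w (conc L K) \<in> (\<lambda>(X, Y). conc X K \<union> \<Union>Y) ` ?S" for w
  proof (rule image_eqI)
    show "lquot w (conc L K) =
      (\<lambda>(X, Y). conc X K \<union> \<Union>Y) (lquot w L, {lquot v K | u v. w = u @ v \<and> u \<in> L})"
      by (simp add: lquot_conc)
  qed blast
  then have "range (\<lambda>w. lquot w (conc L K)) \<subseteq> (\<lambda>(X, Y). conc X K \<union> \<Union>Y) ` ?S"
    by blast
  moreover have "finite ?S"
    using assms by (simp add: regular_def)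
  ultimately have "finite (range (\<lambda>w. lquot w (conc L K)))"
    by (meson finite_imageI finite_subset)
  moreover obtain A B where "finite A" "finite B" "L \<subseteq> lists A" "K \<subseteq> lists B"
    using assms by (auto simp: regular_def)
  then have AB: "finite (A \<union> B)" "L \<subseteq> lists (A \<union> B)" "K \<subseteq> lists (A \<union> B)"
    using lists_mono[of A "A \<union> B"] lists_mono[of B "A \<union> B"] by blast+
  then have "w \<in> lists (A \<union> B)" if "w \<in> conc L K" for w
  proof -
    from that AB obtain u v
      where "w = u @ v" "u \<in> lists (A \<union> B)" "v \<in> lists (A \<union> B)"
      unfolding conc_def by blast
    then show ?thesis by simp
  qed
  with AB(1) have "\<exists>A. finite A \<and> conc L K \<subseteq> lists A"
    by blast
  ultimately show ?thesis
    unfolding regular_def by blast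
qed

lemma star_append: "u \<in> star L \<Longrightarrow> v \<in> star L \<Longrightarrow> u @ v \<in> star L"
  by (induction rule: star.induct) (auto intro: star.intros)

text \<open>The end of \<open>w\<close> falls into one factor of the iteration and cuts it into
  \<open>v\<close> and \<open>p\<close>. For \<open>w = []\<close> there need not be any factor to
  cut.\<close>

lemma star_split:
  assumes "y \<in> star L" "y = w @ x" "w \<noteq> []"
  shows "\<exists>u v p q. w = u @ v \<and> u \<in> star L \<and> x = p @ q \<and> v @ p \<in> L \<and> q \<in> star L"
  using assms
proof (induction arbitrary: w rule: star.induct)
  case (append a b)
  from append.prems(1) consider us where "a = w @ us" "x = us @ b"
    | us where "us \<noteq> []" "w = a @ us" "b = us @ x"
    by (cases "\<exists>us. a = w @ us \<and> x = us @ b") (auto simp: append_eq_append_conv2)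
  then show ?case
  proof cases
    case 1
    then show ?thesis using append star.Nil by fastforce
  next
    case 2
    from append.IH[OF 2(3,1)] obtain u v p q
      where "us = u @ v" "u \<in> star L" "x = p @ q" "v @ p \<in> L" "q \<in> star L"
      by blast
    then show ?thesis
      using 2 append.hyps(1)
      by (intro exI[of _ "a @ u"] exI[of _ v] exI[of _ p] exI[of _ q]) (auto intro: star.append)
  qed
qed auto

lemma lquot_star:
  assumes "w \<noteq> []"
  shows "lquot w (star L) = \<Union>{conc (lquot v L) (star L) | u v. w = u @ v \<and> u \<in> star L}"
proof (intro set_eqI iffI)
  fix x assume "x \<in> lquot w (star L)"
  then obtain u v p q where "w = u @ v" "u \<in> star L" "x = p @ q" "v @ p \<in> L" "q \<in> star L"
    using star_split[of "w @ x" L w x] assms unfolding lquot_def by blast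
  then show "x \<in> \<Union>{conc (lquot v L) (star L) | u v. w = u @ v \<and> u \<in> star L}"
    by (auto simp: conc_def lquot_def)
next
  fix x assume "x \<in> \<Union>{conc (lquot v L) (star L) | u v. w = u @ v \<and> u \<in> star L}"
  then obtain u v p q where "w = u @ v" "u \<in> star L" "x = p @ q" "v @ p \<in> L" "q \<in> star L"
    by (auto simp: conc_def lquot_def)
  moreover from this have "u @ (v @ p) @ q \<in> star L"
    by (intro star_append star.append)
  ultimately show "x \<in> lquot w (star L)"
    by (simp add: lquot_def)
qed

text \<open>A quotient by a nonempty word is a union of sets \<open>conc X (star L)\<close>, where
  \<open>X\<close> ranges over a set of quotients of \<open>L\<close>; the empty word leaves
  \<open>star L\<close> itself.\<close>

lemma regular_star:
  assumes "regular L"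
  shows "regular (star L)"
proof -
  let ?S = "Pow (range (\<lambda>w. lquot w L))"
  have "lquot w (star L) \<in> insert (star L) ((\<lambda>Y. \<Union>X\<in>Y. conc X (star L)) ` ?S)" for w
  proof (cases "w = []")
    case False
    then have "lquot w (star L) =
        (\<Union>X\<in>{lquot v L | u v. w = u @ v \<and> u \<in> star L}. conc X (star L))"
      by (auto simp: lquot_star)
    then show ?thesis by blast
  qed (simp add: lquot_def)
  moreover have "finite (insert (star L) ((\<lambda>Y. \<Union>X\<in>Y. conc X (star L)) ` ?S))"
    using assms by (simp add: regular_def)
  ultimately have "finite (range (\<lambda>w. lquot w (star L)))"
    by (intro finite_subset[OF image_subsetI])
  moreover obtain A where A: "finite A" "L \<subseteq> lists A"
    using assms by (auto simp: regular_def)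
  have "w \<in> lists A" if "w \<in> star L" for w
    using that A(2) by (induction rule: star.induct) auto
  with A(1) have "\<exists>A. finite A \<and> star L \<subseteq> lists A" by blast
  ultimately show ?thesis by (simp add: regular_def)
qed

section \<open>Counter programs\<close>

datatype instr = Inc nat | Dec nat | Tst nat

type_synonym store = "nat \<Rightarrow> nat"

text \<open>An instruction that cannot be executed has no successor store. So programs need no
  jumps: among all words of the language, failing tests discard the wrong ones.\<close>

fun step :: "instr \<Rightarrow> store \<Rightarrow> store set" where
  "step (Inc c) s = {s(c := Suc (s c))}"
| "step (Dec c) s = (if s c = 0 then {} else {s(c := s c - 1)})"
| "step (Tst c) s = (if s c = 0 then {s} else {})"

fun run :: "instr list \<Rightarrow> store \<Rightarrow> store set" where
  "run [] s = {s}"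
| "run (i # w) s = (\<Union>s'\<in>step i s. run w s')"

definition sem :: "instr list set \<Rightarrow> store \<Rightarrow> store set" where
  "sem R s = (\<Union>w\<in>R. run w s)"

definition seq :: "(store \<Rightarrow> store set) \<Rightarrow> (store \<Rightarrow> store set) \<Rightarrow> store \<Rightarrow> store set"
    (infixr \<open>;;\<close> 60) where
  "(F ;; G) s = (\<Union>s'\<in>F s. G s')"

definition repeat :: "(store \<Rightarrow> store set) \<Rightarrow> store \<Rightarrow> store set" where
  "repeat F s = {(s, s'). s' \<in> F s}\<^sup>* `` {s}"

definition programmable :: "(store \<Rightarrow> store set) \<Rightarrow> bool" where
  "programmable F \<longleftrightarrow> (\<exists>R. regular R \<and> sem R = F)"

lemma run_append: "run (u @ v) = run u ;; run v"
proof
  show "run (u @ v) s = (run u ;; run v) s" for s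
    by (induction u arbitrary: s) (simp_all add: seq_def)
qed

lemma programmable_empty: "programmable (\<lambda>s. {})"
  unfolding programmable_def by (intro exI[of _ "{}"]) (auto simp: regular_empty sem_def)

lemma programmable_skip: "programmable (\<lambda>s. {s})"
  unfolding programmable_def by (intro exI[of _ "{[]}"]) (auto simp: regular_Nil sem_def)

lemma programmable_step: "programmable (step i)"
  unfolding programmable_def by (intro exI[of _ "{[i]}"]) (auto simp: regular_single sem_def)

lemma sem_conc: "sem (conc L K) = sem L ;; sem K"
proof
  fix s
  have "sem (conc L K) s = (\<Union>u\<in>L. \<Union>v\<in>K. run (u @ v) s)"
    by (auto simp: sem_def conc_def)
  also have "\<dots> = (sem L ;; sem K) s"
    by (auto simp: run_append seq_def sem_def)
  finally show "sem (conc L K) s = (sem L ;; sem K) s" .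
qed

lemma programmable_seq: "programmable F \<Longrightarrow> programmable G \<Longrightarrow> programmable (F ;; G)"
  unfolding programmable_def using regular_conc sem_conc by metis

lemma sem_star: "sem (star R) = repeat (sem R)"
proof (intro ext set_eqI iffI)
  fix s s'
  let ?r = "{(s, s'). s' \<in> sem R s}"
  have "s' \<in> run w s \<Longrightarrow> (s, s') \<in> ?r\<^sup>*" if "w \<in> star R" for w
    using that
  proof (induction arbitrary: s rule: star.induct)
    case (append u v)
    then obtain t where "t \<in> run u s" "(t, s') \<in> ?r\<^sup>*"
      by (auto simp: run_append seq_def)
    moreover from this append have "(s, t) \<in> ?r"
      by (auto simp: sem_def)
    ultimately show ?case by (meson converse_rtrancl_into_rtrancl)
  qed simp
  then show "s' \<in> sem (star R) s \<Longrightarrow> s' \<in> repeat (sem R) s"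
    by (auto simp: sem_def repeat_def)
  assume "s' \<in> repeat (sem R) s"
  then have "(s, s') \<in> ?r\<^sup>*" by (simp add: repeat_def)
  then show "s' \<in> sem (star R) s"
  proof (induction rule: converse_rtrancl_induct)
    case base
    then show ?case
      unfolding sem_def by (intro UN_I[OF star.Nil]) simp
  next
    case (step s t)
    then obtain u v where "u \<in> R" "t \<in> run u s" "v \<in> star R" "s' \<in> run v t"
      by (auto simp: sem_def)
    then show ?case
      unfolding sem_def by (intro UN_I[OF star.append, of u _ v]) (auto simp: run_append seq_def)
  qed
qed

lemma programmable_repeat: "programmable F \<Longrightarrow> programmable (repeat F)"
  unfolding programmable_def using regular_star sem_star by metis

section \<open>Deterministic loops and register operations\<close>

lemma seq_single: "F s = {t} \<Longrightarrow> (F ;; G) s = G t"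
  by (simp add: seq_def)

lemma seq_empty: "F s = {} \<Longrightarrow> (F ;; G) s = {}"
  by (simp add: seq_def)

lemma repeat_unfold: "repeat F s = insert s ((F ;; repeat F) s)"
proof -
  have "{(s, s'). s' \<in> F s}\<^sup>* `` {s} = insert s (\<Union>t\<in>F s. {(s, s'). s' \<in> F s}\<^sup>* `` {t})"
    by (auto intro: converse_rtrancl_into_rtrancl elim: converse_rtranclE)
  then show ?thesis by (simp add: repeat_def seq_def)
qed

lemma loop_exit: "F s = {} \<Longrightarrow> (repeat F ;; G) s = G s"
  by (subst seq_def, subst repeat_unfold) (simp add: seq_def)

text \<open>\<open>repeat\<close> guesses the number of rounds. Stopping at \<open>s\<close> is
  excluded since the continuation \<open>G\<close> fails there, so one more round is forced.\<close>

lemma loop_step: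
  assumes "F s = {t}" "G s = {}"
  shows "(repeat F ;; G) s = (repeat F ;; G) t"
  by (subst seq_def, subst repeat_unfold) (simp add: seq_def assms)

lemmas programmable_intros =
  programmable_empty programmable_skip programmable_step programmable_seq programmable_repeat

definition clear :: "nat \<Rightarrow> store \<Rightarrow> store set" where
  "clear c = repeat (step (Dec c)) ;; step (Tst c)"

definition move :: "nat \<Rightarrow> nat \<Rightarrow> store \<Rightarrow> store set" where
  "move a b = repeat (step (Dec a) ;; step (Inc b)) ;; step (Tst a)"

text \<open>The loop empties \<open>a\<close> into \<open>b\<close> and \<open>t\<close>
  simultaneously; the final move restores \<open>a\<close> from \<open>t\<close>.\<close>

definition copy :: "nat \<Rightarrow> nat \<Rightarrow> nat \<Rightarrow> store \<Rightarrow> store set" where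
  "copy a b t = (repeat (step (Dec a) ;; step (Inc b) ;; step (Inc t)) ;; step (Tst a)) ;; move t a"

lemma programmable_clear: "programmable (clear c)"
  and programmable_move: "programmable (move a b)"
  and programmable_copy: "programmable (copy a b t)"
  unfolding clear_def copy_def move_def by (intro programmable_intros)+

lemma clear: "clear c s = {s(c := 0)}"
proof (induction "s c" arbitrary: s)
  case 0
  then show ?case by (auto simp: clear_def loop_exit fun_upd_idem)
next
  case (Suc x)
  have s: "s c = Suc x" using Suc.hyps(2) by simp
  let ?t = "s(c := x)"
  have "clear c s = clear c ?t"
    using s unfolding clear_def by (intro loop_step) auto
  also have "\<dots> = {?t(c := 0)}" using Suc.hyps(1)[of ?t] by simp
  finally show ?case by simp
qed

lemma move:
  assumes "a \<noteq> b"
  shows "move a b s = {s(b := s b + s a, a := 0)}"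
proof (induction "s a" arbitrary: s)
  case 0
  have "(step (Dec a) ;; step (Inc b)) s = {}" using 0 by (simp add: seq_empty)
  then show ?case using 0 by (auto simp: move_def loop_exit)
next
  case (Suc x)
  have s: "s a = Suc x" using Suc.hyps(2) by simp
  let ?t = "s(a := x, b := Suc (s b))"
  have "(step (Dec a) ;; step (Inc b)) s = {?t}"
    using s assms by (simp add: seq_def fun_upd_twist)
  then have "move a b s = move a b ?t"
    using s unfolding move_def by (intro loop_step) auto
  also have "\<dots> = {s(b := s b + s a, a := 0)}"
    using Suc.hyps(1)[of ?t] assms s by (auto simp: fun_eq_iff)
  finally show ?case .
qed

lemma copy_first:
  assumes "a \<noteq> b" "a \<noteq> t" "b \<noteq> t"
  shows "(repeat (step (Dec a) ;; step (Inc b) ;; step (Inc t)) ;; step (Tst a)) s =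
    {s(b := s b + s a, t := s t + s a, a := 0)}" (is "?F s = _")
proof (induction "s a" arbitrary: s)
  case 0
  have "(step (Dec a) ;; step (Inc b) ;; step (Inc t)) s = {}" using 0 by (simp add: seq_empty)
  then have "?F s = step (Tst a) s" by (simp add: loop_exit del: step.simps)
  then show ?case using 0 by (auto simp: fun_eq_iff)
next
  case (Suc x)
  have s: "s a = Suc x" using Suc.hyps(2) by simp
  let ?t = "s(a := x, b := Suc (s b), t := Suc (s t))"
  have "?F s = ?F ?t"
  proof (rule loop_step)
    show "(step (Dec a) ;; step (Inc b) ;; step (Inc t)) s = {?t}"
      using s assms by (auto simp: seq_def fun_eq_iff)
  qed (simp add: s)
  also have "\<dots> = {?t(b := ?t b + ?t a, t := ?t t + ?t a, a := 0)}"
    using assms by (intro Suc.hyps(1)) simp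
  also have "\<dots> = {s(b := s b + s a, t := s t + s a, a := 0)}"
    using assms s by (auto simp: fun_eq_iff)
  finally show ?case .
qed

lemma copy:
  assumes "a \<noteq> b" "a \<noteq> t" "b \<noteq> t" "s b = 0" "s t = 0"
  shows "copy a b t s = {s(b := s a)}"
  unfolding copy_def
  by (subst seq_single, rule copy_first) (use assms in \<open>auto simp: move fun_eq_iff\<close>)

section \<open>Compilation of partial recursive functions\<close>

primrec put :: "nat \<Rightarrow> nat list \<Rightarrow> store \<Rightarrow> store" where
  "put m [] s = s"
| "put m (y # ys) s = put (Suc m) ys (s(m := y))"

lemma put_outside: "i < m \<or> m + length ys \<le> i \<Longrightarrow> put m ys s i = s i"
  by (induction ys arbitrary: m s) auto

lemma map_put: "map (put m ys s) [m..<m + length ys] = ys"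
proof (induction ys arbitrary: m s)
  case (Cons y ys)
  have "[m..<m + length (y # ys)] = m # [Suc m..<Suc m + length ys]"
    by (simp add: upt_conv_Cons del: upt_Suc)
  then have "map (put m (y # ys) s) [m..<m + length (y # ys)] =
      y # map (put (Suc m) ys (s(m := y))) [Suc m..<Suc m + length ys]"
    by (simp add: put_outside del: upt_Suc)
  also have "map (put (Suc m) ys (s(m := y))) [Suc m..<Suc m + length ys] = ys"
    by (rule Cons)
  finally show ?case .
qed simp

primrec clear_all :: "nat list \<Rightarrow> store \<Rightarrow> store set" where
  "clear_all [] = (\<lambda>s. {s})"
| "clear_all (c # cs) = clear c ;; clear_all cs"

lemma programmable_clear_all: "programmable (clear_all cs)"
  by (induction cs) (auto intro: programmable_intros programmable_clear)

lemma clear_all: "clear_all cs s = {\<lambda>i. if i \<in> set cs then 0 else s i}"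
  by (induction cs arbitrary: s) (auto simp: seq_single[OF clear] fun_eq_iff)

text \<open>
  Calling convention: the registers from \<open>m\<close> on are scratch space, and the arguments, in the
  registers \<open>as\<close> below \<open>m\<close>, survive the call.
\<close>

definition implements :: "(store \<Rightarrow> store set) \<Rightarrow> recf \<Rightarrow> nat list \<Rightarrow> nat \<Rightarrow> bool" where
  "implements F f as m \<longleftrightarrow> programmable F \<and>
     (\<forall>s. (\<forall>i\<ge>m. s i = 0) \<longrightarrow>
        F s = (case rec_eval f (map s as) of None \<Rightarrow> {} | Some y \<Rightarrow> {s(m := y)}))"

lemma implementsD:
  assumes "implements F f as m" "\<And>i. i \<ge> m \<Longrightarrow> s i = 0" "map s as = xs"
  shows "F s = (case rec_eval f xs of None \<Rightarrow> {} | Some y \<Rightarrow> {s(m := y)})"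
  using assms unfolding implements_def by blast

lemma map_store_cong:
  "set as \<subseteq> {..<m} \<Longrightarrow> (\<And>i. i < m \<Longrightarrow> s i = t i) \<Longrightarrow> map s as = map t as"
  by (auto simp: subset_iff)

text \<open>The arguments of a composition are evaluated one after another. Each result stays in the
  lowest scratch register, and the next call works above it; a diverging call leaves no store at
  all.\<close>

lemma implements_args:
  assumes "\<And>g m. g \<in> set gs \<Longrightarrow> set as \<subseteq> {..<m} \<Longrightarrow> \<exists>F. implements F g as m"
    and "set as \<subseteq> {..<m}"
  shows "\<exists>F. programmable F \<and> (\<forall>s. (\<forall>i\<ge>m. s i = 0) \<longrightarrow>
     F s = (case those (map (\<lambda>g. rec_eval g (map s as)) gs) of None \<Rightarrow> {} | Some ys \<Rightarrow> {put m ys s}))"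
  using assms
proof (induction gs arbitrary: m)
  case Nil
  then show ?case by (intro exI[of _ "\<lambda>s. {s}"]) (simp add: programmable_intros)
next
  case (Cons g gs)
  have sub: "set as \<subseteq> {..<Suc m}" using Cons.prems(2) by auto
  obtain G where G: "implements G g as m"
    using Cons.prems by fastforce
  obtain F where F: "programmable F" "\<And>s. (\<forall>i\<ge>Suc m. s i = 0) \<Longrightarrow>
     F s = (case those (map (\<lambda>g. rec_eval g (map s as)) gs) of None \<Rightarrow> {} | Some ys \<Rightarrow> {put (Suc m) ys s})"
    using Cons.IH[OF Cons.prems(1) sub] by auto
  show ?case
  proof (intro exI[of _ "G ;; F"] conjI allI impI)
    show "programmable (G ;; F)"
      using F G by (simp add: implements_def programmable_seq)
    fix s assume s: "\<forall>i\<ge>m. s i = (0 :: nat)"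
    show "(G ;; F) s = (case those (map (\<lambda>g. rec_eval g (map s as)) (g # gs)) of
        None \<Rightarrow> {} | Some ys \<Rightarrow> {put m ys s})"
    proof (cases "rec_eval g (map s as)")
      case None
      then show ?thesis using G s by (simp add: implements_def seq_empty)
    next
      case (Some y)
      then have "(G ;; F) s = F (s(m := y))"
        using G s by (intro seq_single) (simp add: implements_def)
      moreover have map_upd: "map (s(m := y)) as = map s as"
        using Cons.prems(2) by (intro map_store_cong) auto
      have "F (s(m := y)) = (case those (map (\<lambda>g. rec_eval g (map s as)) gs) of
          None \<Rightarrow> {} | Some ys \<Rightarrow> {put (Suc m) ys (s(m := y))})"
        using F(2)[of "s(m := y)"] s unfolding map_upd by simp
      ultimately show ?thesis using Some by (simp split: option.splits)
    qed
  qed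
qed

lemma length_those: "those xs = Some ys \<Longrightarrow> length ys = length xs"
  by (induction xs arbitrary: ys) (auto split: option.splits)

lemma implements_Comp:
  assumes f: "\<And>as m. set as \<subseteq> {..<m} \<Longrightarrow> \<exists>F. implements F f as m"
    and gs: "\<And>g as m. g \<in> set gs \<Longrightarrow> set as \<subseteq> {..<m} \<Longrightarrow> \<exists>F. implements F g as m"
    and as: "set as \<subseteq> {..<m}"
  shows "\<exists>F. implements F (Comp f gs) as m"
proof -
  obtain G where G: "programmable G" "\<And>s. (\<forall>i\<ge>m. s i = 0) \<Longrightarrow>
     G s = (case those (map (\<lambda>g. rec_eval g (map s as)) gs) of None \<Rightarrow> {} | Some ys \<Rightarrow> {put m ys s})"
    using implements_args[OF gs as] by blast
  let ?l = "length gs"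
  obtain F where F: "implements F f [m..<m + ?l] (m + ?l)"
    using f[of "[m..<m + ?l]" "m + ?l"] by (auto simp: subset_iff)
  \<comment> \<open>\<open>H\<close> erases the argument values and moves the result down to
    register \<open>m\<close>. Without arguments the result is in \<open>m\<close> already, and
    \<open>move\<close> would need two distinct registers.\<close>
  define H where "H = clear_all [m..<m + ?l] ;; (if ?l = 0 then (\<lambda>s. {s}) else move (m + ?l) m)"
  show ?thesis
    unfolding implements_def
  proof (intro exI[of _ "G ;; F ;; H"] conjI allI impI)
    have "programmable H"
      unfolding H_def by (auto intro!: programmable_intros programmable_clear_all programmable_move)
    then show "programmable (G ;; F ;; H)"
      using F G(1) by (auto intro!: programmable_intros simp: implements_def)
    fix s assume s: "\<forall>i\<ge>m. s i = (0 :: nat)"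
    show "(G ;; F ;; H) s = (case rec_eval (Comp f gs) (map s as) of None \<Rightarrow> {} | Some y \<Rightarrow> {s(m := y)})"
    proof (cases "those (map (\<lambda>g. rec_eval g (map s as)) gs)")
      case None
      then show ?thesis using G(2)[OF s] by (simp add: seq_empty)
    next
      case (Some ys)
      let ?t = "put m ys s"
      have len: "length ys = ?l"
        using length_those[OF Some] by simp
      have "(G ;; F ;; H) s = (F ;; H) ?t"
        using Some G(2)[OF s] by (intro seq_single) simp
      moreover have "\<forall>i\<ge>m + ?l. ?t i = 0"
        using s len by (simp add: put_outside)
      then have Ft: "F ?t = (case rec_eval f ys of None \<Rightarrow> {} | Some y \<Rightarrow> {?t(m + ?l := y)})"
        using implementsD[OF F, of ?t ys] map_put[of m ys s] len by simp
      ultimately show ?thesis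
      proof (cases "rec_eval f ys")
        case None
        then show ?thesis using Ft Some \<open>(G ;; F ;; H) s = _\<close> by (simp add: seq_empty)
      next
        case (Some y)
        have "(F ;; H) ?t = H (?t(m + ?l := y))"
          using Ft Some by (intro seq_single) simp
        also have "\<dots> = {s(m := y)}"
        proof -
          let ?u = "\<lambda>i. if i \<in> set [m..<m + ?l] then 0 else (?t(m + ?l := y)) i"
          have u: "?u i = (if i = m + ?l then y else s i)" for i
            using s len put_outside[of i m ys s] by auto
          have "H (?t(m + ?l := y)) = (if ?l = 0 then (\<lambda>s. {s}) else move (m + ?l) m) ?u"
            unfolding H_def by (intro seq_single clear_all)
          also have "\<dots> = {s(m := y)}"
            unfolding u using s by (auto simp: move fun_eq_iff)
          finally show ?thesis .
        qed
        finally show ?thesis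
          using Some \<open>those _ = _\<close> \<open>(G ;; F ;; H) s = _\<close> by simp
      qed
    qed
  qed
qed

lemma implements_PrimRec:
  assumes f: "\<And>as m. set as \<subseteq> {..<m} \<Longrightarrow> \<exists>F. implements F f as m"
    and g: "\<And>as m. set as \<subseteq> {..<m} \<Longrightarrow> \<exists>F. implements F g as m"
    and as: "set (a # as) \<subseteq> {..<m}"
  shows "\<exists>F. implements F (PrimRec f g) (a # as) m"
proof -
  obtain F where F: "implements F f as (m + 2)"
    using f[of as "m + 2"] as by force
  obtain G where G: "implements G g ((m + 1) # (m + 2) # as) (m + 3)"
    using g[of "(m + 1) # (m + 2) # as" "m + 3"] as by force
  \<comment> \<open>Register \<open>m\<close> holds the rounds left, \<open>m + 1\<close> the rounds
    done and \<open>m + 2\<close> the current value; \<open>g\<close> delivers the next value in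
    \<open>m + 3\<close>.\<close>
  define body where
    "body = step (Dec m) ;; G ;; clear (m + 2) ;; move (m + 3) (m + 2) ;; step (Inc (m + 1))"
  define final where "final = step (Tst m) ;; clear (m + 1) ;; move (m + 2) m"
  let ?P = "copy a m (m + 1) ;; F ;; repeat body ;; final"
  have "programmable ?P"
    using F G unfolding body_def final_def implements_def
    by (intro programmable_intros programmable_copy programmable_clear programmable_move) auto
  moreover have "?P s = (case rec_eval (PrimRec f g) (map s (a # as)) of None \<Rightarrow> {} | Some y \<Rightarrow> {s(m := y)})"
    if s: "\<forall>i\<ge>m. s i = 0" for s
  proof -
    let ?xs = "map s as"
    \<comment> \<open>\<open>R j\<close> is the value after \<open>j\<close> rounds, and
      \<open>None\<close> once a call has diverged.\<close>
    define R where "R = rec_nat (rec_eval f ?xs) (\<lambda>i r. Option.bind r (\<lambda>y. rec_eval g (i # y # ?xs)))"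
    define st where "st = (\<lambda>r j y. s(m := r, m + 1 := j, m + 2 := y))"
    have st_args: "map (st r j y) as = ?xs" for r j y
      using as by (intro map_store_cong) (auto simp: st_def)
    have body_0: "body (st 0 j y) = {}" for j y
      unfolding body_def by (intro seq_empty) (simp add: st_def)
    have body_Suc: "body (st (Suc r) j y) =
        (case rec_eval g (j # y # ?xs) of None \<Rightarrow> {} | Some z \<Rightarrow> {st r (Suc j) z})" for r j y
    proof -
      have body_G: "body (st (Suc r) j y) =
          (G ;; clear (m + 2) ;; move (m + 3) (m + 2) ;; step (Inc (m + 1))) (st r j y)"
        unfolding body_def by (intro seq_single) (simp add: st_def fun_upd_twist)
      moreover have "map (st r j y) ((m + 1) # (m + 2) # as) = j # y # ?xs"
        using st_args by (simp add: st_def)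
      then have Gs: "G (st r j y) = (case rec_eval g (j # y # ?xs) of None \<Rightarrow> {} | Some z \<Rightarrow> {(st r j y)(m + 3 := z)})"
        using s by (intro implementsD[OF G]) (auto simp: st_def)
      ultimately show ?thesis
      proof (cases "rec_eval g (j # y # ?xs)")
        case None
        then show ?thesis using Gs body_G by (simp add: seq_empty)
      next
        case (Some z)
        then have "body (st (Suc r) j y) =
          (clear (m + 2) ;; move (m + 3) (m + 2) ;; step (Inc (m + 1))) ((st r j y)(m + 3 := z))"
          using Gs body_G by (simp add: seq_single)
        also have "\<dots> = {st r (Suc j) z}"
          using s by (auto simp: seq_def clear move st_def fun_eq_iff)
        finally show ?thesis using Some by simp
      qed
    qed
    have final_0: "final (st 0 j y) = {s(m := y)}" for j y
      using s unfolding final_def by (auto simp: seq_def clear move st_def fun_eq_iff)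
    have final_Suc: "final (st (Suc r) j y) = {}" for r j y
      unfolding final_def by (intro seq_empty) (simp add: st_def)
    have R_None: "R j = None \<Longrightarrow> R (j + r) = None" for j r
      by (induction r) (simp_all add: R_def)
    \<comment> \<open>Leaving the loop with rounds left fails at \<open>Tst m\<close>, and
      \<open>body\<close> fails when none are left; so exactly \<open>r\<close> more rounds are
      executed.\<close>
    have loop: "R j = Some y \<Longrightarrow> (repeat body ;; final) (st r j y) =
        (case R (j + r) of None \<Rightarrow> {} | Some z \<Rightarrow> {s(m := z)})" for r j y
    proof (induction r arbitrary: j y)
      case 0
      then show ?case by (simp add: loop_exit body_0 final_0)
    next
      case (Suc r)
      have R_Suc: "R (Suc j) = rec_eval g (j # y # ?xs)"
        using Suc.prems by (simp add: R_def)
      show ?case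
      proof (cases "R (Suc j)")
        case None
        then have "body (st (Suc r) j y) = {}" by (simp add: body_Suc flip: R_Suc)
        then show ?thesis
          using R_None[OF None, of r] by (simp add: loop_exit final_Suc)
      next
        case (Some z)
        then have "body (st (Suc r) j y) = {st r (Suc j) z}" by (simp add: body_Suc flip: R_Suc)
        then show ?thesis
          using Suc.IH[OF Some] by (simp add: loop_step final_Suc)
      qed
    qed
    have "?P s = (F ;; repeat body ;; final) (s(m := s a))"
      using s as by (intro seq_single copy) auto
    moreover have "map (s(m := s a)) as = ?xs"
      using as by (intro map_store_cong) auto
    then have Fs: "F (s(m := s a)) = (case R 0 of None \<Rightarrow> {} | Some y \<Rightarrow> {st (s a) 0 y})"
      using implementsD[OF F, of "s(m := s a)" ?xs] s
      by (simp add: st_def R_def fun_upd_idem split: option.splits)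
    ultimately have "?P s = (case R (s a) of None \<Rightarrow> {} | Some y \<Rightarrow> {s(m := y)})"
    proof (cases "R 0")
      case None
      then show ?thesis
        using Fs \<open>?P s = _\<close> R_None[of 0 "s a"] by (simp add: seq_empty)
    next
      case (Some y)
      then have "(F ;; repeat body ;; final) (s(m := s a)) = (repeat body ;; final) (st (s a) 0 y)"
        using Fs by (intro seq_single) simp
      then show ?thesis
        using \<open>?P s = _\<close> loop[OF Some, of "s a"] by simp
    qed
    then show ?thesis by (simp add: R_def)
  qed
  ultimately show ?thesis unfolding implements_def by blast
qed

lemma implements_Mu:
  assumes f: "\<And>as m. set as \<subseteq> {..<m} \<Longrightarrow> \<exists>F. implements F f as m"
    and as: "set as \<subseteq> {..<m}"
  shows "\<exists>F. implements F (Mu f) as m"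
proof -
  obtain F where F: "implements F f (m # as) (m + 1)"
    using f[of "m # as" "m + 1"] as by force
  \<comment> \<open>Register \<open>m\<close> holds the candidate. \<open>body\<close> passes only
    if the value of \<open>f\<close> is positive, \<open>final\<close> only if it is zero, so the
    loop can be left only at the first zero, after positive values at all smaller arguments.\<close>
  define body where "body = F ;; step (Dec (m + 1)) ;; clear (m + 1) ;; step (Inc m)"
  define final where "final = F ;; step (Tst (m + 1))"
  let ?P = "repeat body ;; final"
  have "programmable ?P"
    using F unfolding body_def final_def implements_def
    by (intro programmable_intros programmable_clear) auto
  moreover have "?P s = (case rec_eval (Mu f) (map s as) of None \<Rightarrow> {} | Some y \<Rightarrow> {s(m := y)})"
    if s: "\<forall>i\<ge>m. s i = 0" for s
  proof -
    let ?xs = "map s as"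
    define st where "st = (\<lambda>j. s(m := j))"
    have st_args: "map (st j) as = ?xs" for j
      using as by (intro map_store_cong) (auto simp: st_def)
    have Fs: "F (st j) = (case rec_eval f (j # ?xs) of None \<Rightarrow> {} | Some y \<Rightarrow> {(st j)(m + 1 := y)})" for j
    proof -
      have "map (st j) (m # as) = j # ?xs"
        using st_args by (simp add: st_def)
      then show ?thesis
        using s by (intro implementsD[OF F]) (auto simp: st_def)
    qed
    have body: "body (st j) = (if \<exists>y. rec_eval f (j # ?xs) = Some (Suc y) then {st (Suc j)} else {})" for j
      using s unfolding body_def seq_def Fs
      by (cases "rec_eval f (j # ?xs)") (auto simp: clear st_def fun_eq_iff gr0_conv_Suc)
    have final: "final (st j) = (if rec_eval f (j # ?xs) = Some 0 then {st j} else {})" for j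
      using s unfolding final_def seq_def Fs
      by (cases "rec_eval f (j # ?xs)") (auto simp: st_def fun_eq_iff)
    have st_0: "s = st 0" using s by (auto simp: st_def fun_eq_iff)
    define zero_at where "zero_at n \<longleftrightarrow> rec_eval f (n # ?xs) = Some 0 \<and>
      (\<forall>m<n. \<exists>y. rec_eval f (m # ?xs) = Some (Suc y))" for n
    show ?thesis
    proof (cases "\<exists>n. zero_at n")
      case True
      then obtain n where n: "zero_at n" by blast
      then have "n' = n" if "zero_at n'" for n'
        using that unfolding zero_at_def
        by (metis linorder_neqE_nat nat.distinct(1) option.inject)
      with n have "(THE n. zero_at n) = n" by blast
      with n have ev: "rec_eval (Mu f) ?xs = Some n"
        unfolding rec_eval.simps Let_def zero_at_def[symmetric] by auto
      have P_st: "?P (st j) = {st n}" if "j \<le> n" for j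
        using that
      proof (induction j rule: inc_induct)
        case base
        have "body (st n) = {}" using n by (simp add: body zero_at_def)
        then show ?case using n by (simp add: loop_exit final zero_at_def)
      next
        case (step j)
        have "body (st j) = {st (Suc j)}" "final (st j) = {}"
          using n step.hyps by (auto simp: body final zero_at_def)
        then show ?case using step.IH by (simp add: loop_step)
      qed
      from P_st[of 0] have "?P s = {st n}" by (simp flip: st_0)
      with ev show ?thesis by (simp add: st_def)
    next
      case False
      then have ev: "rec_eval (Mu f) ?xs = None"
        unfolding rec_eval.simps Let_def zero_at_def[symmetric] by auto
      \<comment> \<open>Every store that the loop reaches is a candidate with positive values at all
        smaller arguments. As no \<open>zero_at\<close> holds, \<open>final\<close> fails at each of
        them.\<close>
      have reach: "\<exists>j. t = st j \<and> (\<forall>i<j. \<exists>y. rec_eval f (i # ?xs) = Some (Suc y))"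
        if "(s, t) \<in> {(s, s'). s' \<in> body s}\<^sup>*" for t
        using that
      proof (induction rule: rtrancl_induct)
        case base
        then show ?case using st_0 by blast
      next
        case (step t u)
        then obtain j where "t = st j" "\<forall>i<j. \<exists>y. rec_eval f (i # ?xs) = Some (Suc y)" by blast
        moreover from this step have "u = st (Suc j)" "\<exists>y. rec_eval f (j # ?xs) = Some (Suc y)"
          by (auto simp: body split: if_splits)
        ultimately show ?case by (metis less_Suc_eq)
      qed
      have "final t = {}" if "t \<in> repeat body s" for t
      proof -
        from that obtain j where "t = st j" "\<forall>i<j. \<exists>y. rec_eval f (i # ?xs) = Some (Suc y)"
          using reach unfolding repeat_def by blast
        moreover have "\<not> zero_at j" using False by blast
        ultimately show ?thesis by (simp add: zero_at_def final)
      qed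
      then have "?P s = {}" by (simp add: seq_def)
      with ev show ?thesis by simp
    qed
  qed
  ultimately show ?thesis unfolding implements_def by blast
qed

text \<open>The induction is for all \<open>as\<close> and \<open>m\<close> at once, since inner
  calls get other argument registers and a higher scratch bound. A call of unsuitable arity is
  implemented by the empty program.\<close>

theorem ex_implements: "set as \<subseteq> {..<m} \<Longrightarrow> \<exists>F. implements F f as m"
proof (induction f arbitrary: as m)
  case Zero
  show ?case
    unfolding implements_def
    by (intro exI[of _ "\<lambda>s. {s}"]) (auto intro: programmable_intros)
next
  case Succ
  show ?case
  proof (cases "\<exists>a. as = [a]")
    case True
    then obtain a where a: "as = [a]" by blast
    show ?thesis
      unfolding implements_def a
    proof (intro exI[of _ "copy a m (m + 1) ;; step (Inc m)"] conjI allI impI)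
      show "programmable (copy a m (m + 1) ;; step (Inc m))"
        by (intro programmable_intros programmable_copy)
      fix s assume "\<forall>i\<ge>m. s i = (0 :: nat)"
      then have "(copy a m (m + 1) ;; step (Inc m)) s = step (Inc m) (s(m := s a))"
        using Succ a by (intro seq_single copy) auto
      then show "(copy a m (m + 1) ;; step (Inc m)) s =
          (case rec_eval Succ (map s [a]) of None \<Rightarrow> {} | Some y \<Rightarrow> {s(m := y)})"
        by simp
    qed
  next
    case False
    then have "rec_eval Succ (map s as) = None" for s
      by (auto split: list.splits)
    then show ?thesis
      unfolding implements_def by (intro exI[of _ "\<lambda>s. {}"]) (simp add: programmable_intros del: rec_eval.simps)
  qed
next
  case (Proj i)
  show ?case
  proof (cases "i < length as")
    case True
    then have "as ! i < m" using Proj by (meson lessThan_iff nth_mem subsetD)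
    with True show ?thesis
      unfolding implements_def
      by (intro exI[of _ "copy (as ! i) m (m + 1)"]) (auto simp: copy intro: programmable_copy)
  next
    case False
    then show ?thesis
      unfolding implements_def by (intro exI[of _ "\<lambda>s. {}"]) (simp add: programmable_intros)
  qed
next
  case (Comp f gs)
  show ?case by (rule implements_Comp) (use Comp in auto)
next
  case (PrimRec f g)
  show ?case
  proof (cases as)
    case Nil
    then show ?thesis
      unfolding implements_def by (intro exI[of _ "\<lambda>s. {}"]) (simp add: programmable_intros)
  next
    case (Cons a as')
    then show ?thesis using implements_PrimRec[OF PrimRec.IH] PrimRec.prems by blast
  qed
next
  case (Mu f)
  then show ?case by (intro implements_Mu) auto
qed

section \<open>Data words\<close>

text \<open>
  In a data word every instruction carries an atom, and the value of counter \<open>c\<close> is the number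
  of elements of a set of atoms \<open>S c\<close>: \<open>Inc c\<close> inserts its atom and \<open>Dec c\<close> removes it.
  Whether one guessed atom belongs to one guessed set can be followed with a single register, and
  this is enough to detect every illegal instruction.
\<close>

primrec counter :: "instr \<Rightarrow> nat" where
  "counter (Inc c) = c"
| "counter (Dec c) = c"
| "counter (Tst c) = c"

text \<open>
  \<open>b\<close> tells whether the guessed atom is in the set of counter \<open>c\<close>, \<open>e\<close> whether it is the atom of
  the instruction.
\<close>

primrec track :: "nat \<Rightarrow> bool \<Rightarrow> bool \<Rightarrow> instr \<Rightarrow> bool option" where
  "track c b e (Inc c') = (if c' = c \<and> e then if b then None else Some True else Some b)"
| "track c b e (Dec c') = (if c' = c \<and> e then if b then Some False else None else Some b)"
| "track c b e (Tst c') = (if c' = c \<and> b then None else Some b)"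

fun fault :: "nat \<Rightarrow> atom \<Rightarrow> bool \<Rightarrow> (instr \<times> atom) list \<Rightarrow> bool" where
  "fault c x b [] = False"
| "fault c x b ((i, a) # w) =
     (case track c b (a = x) i of None \<Rightarrow> True | Some b' \<Rightarrow> fault c x b' w)"

fun legal :: "instr \<times> atom \<Rightarrow> (nat \<Rightarrow> atom set) \<Rightarrow> bool" where
  "legal (Inc c, a) S \<longleftrightarrow> a \<notin> S c"
| "legal (Dec c, a) S \<longleftrightarrow> a \<in> S c"
| "legal (Tst c, a) S \<longleftrightarrow> S c = {}"

fun update :: "instr \<times> atom \<Rightarrow> (nat \<Rightarrow> atom set) \<Rightarrow> nat \<Rightarrow> atom set" where
  "update (Inc c, a) S = S(c := insert a (S c))"
| "update (Dec c, a) S = S(c := S c - {a})"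
| "update (Tst c, a) S = S"

lemma track_legal: "legal (i, a) S \<Longrightarrow> track c (x \<in> S c) (a = x) i = Some (x \<in> update (i, a) S c)"
  by (cases i) auto

text \<open>An illegal \<open>Inc\<close> or \<open>Dec\<close> is exposed by tracking its own atom,
  an illegal \<open>Tst\<close> by tracking any member of the set.\<close>

lemma legal_if_tracked:
  assumes "\<And>x. track (counter i) (x \<in> S (counter i)) (a = x) i \<noteq> None"
  shows "legal (i, a) S"
proof (cases i)
  case (Tst c)
  have "x \<notin> S c" for x
    using assms[of x] Tst by (auto split: if_splits)
  then show ?thesis using Tst by auto
qed (use assms[of a] in \<open>auto split: if_splits\<close>)

lemma finite_update: "(\<And>c. finite (S c)) \<Longrightarrow> finite (update (i, a) S c)"
  by (cases i) auto

lemma step_card: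
  assumes "legal (i, a) S" "\<And>c. finite (S c)"
  shows "step i (\<lambda>c. card (S c)) = {\<lambda>c. card (update (i, a) S c)}"
  using assms by (cases i) (auto simp: fun_eq_iff card_gt_0_iff)

text \<open>Finiteness of the sets leaves a fresh atom for \<open>Inc\<close>; a positive counter
  has a member for \<open>Dec\<close> to remove.\<close>

lemma ex_legal:
  assumes "step i (\<lambda>c. card (S c)) \<noteq> {}" "\<And>c. finite (S c)"
  shows "\<exists>a. legal (i, a) S"
proof (cases i)
  case (Inc c)
  then show ?thesis
    using ex_new_if_finite[OF infinite_UNIV_nat assms(2)[of c]] by auto
qed (use assms in \<open>auto split: if_splits\<close>)

text \<open>Absence of faults makes every instruction legal, and legal instructions act on
  cardinalities like \<open>step\<close>. Only counters occurring in \<open>w\<close> are consulted,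
  so finitely many guesses will suffice.\<close>

lemma run_if_faultless:
  assumes "\<And>c x. c \<in> counter ` fst ` set w \<Longrightarrow> \<not> fault c x (x \<in> S c) w" "\<And>c. finite (S c)"
  shows "run (map fst w) (\<lambda>c. card (S c)) \<noteq> {}"
  using assms
proof (induction w arbitrary: S)
  case (Cons ia w)
  obtain i a where ia: "ia = (i, a)" by (cases ia)
  have "track (counter i) (x \<in> S (counter i)) (a = x) i \<noteq> None" for x
    using Cons.prems(1)[of "counter i" x] ia by (auto split: option.splits)
  then have legal: "legal (i, a) S" by (rule legal_if_tracked)
  have "\<not> fault c x (x \<in> update (i, a) S c) w" if "c \<in> counter ` fst ` set w" for c x
    using Cons.prems(1)[of c x] that track_legal[OF legal, of c x] ia by auto
  then have "run (map fst w) (\<lambda>c. card (update (i, a) S c)) \<noteq> {}"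
    using Cons.prems(2) by (intro Cons.IH) (auto intro: finite_update)
  then show ?case
    using step_card[OF legal Cons.prems(2)] ia by simp
qed simp

text \<open>The atoms are chosen along the run so that each instruction is legal; then no tracked
  pair ever sees a fault.\<close>

lemma ex_faultless:
  assumes "run v (\<lambda>c. card (S c)) \<noteq> {}" "\<And>c. finite (S c)"
  shows "\<exists>w. map fst w = v \<and> (\<forall>c x. \<not> fault c x (x \<in> S c) w)"
  using assms
proof (induction v arbitrary: S)
  case (Cons i v)
  then obtain a where legal: "legal (i, a) S"
    using ex_legal[of i S] by (metis UN_empty run.simps(2))
  with Cons.prems have "run v (\<lambda>c. card (update (i, a) S c)) \<noteq> {}"
    using step_card[OF legal Cons.prems(2)] by simp
  then obtain w where w: "map fst w = v" "\<forall>c x. \<not> fault c x (x \<in> update (i, a) S c) w"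
    using Cons.IH[of "update (i, a) S"] Cons.prems(2) finite_update by metis
  then show ?case
    using track_legal[OF legal] by (intro exI[of _ "(i, a) # w"]) simp
qed simp

section \<open>The automata\<close>

text \<open>
  \<open>Accept\<close> accepts every instruction word followed by \<open>Dollar\<close>.  The states \<open>Control k\<close> form the
  complement of a finite automaton for the program, \<open>Member b c\<close> holds the guessed atom and whether
  it is in the set of counter \<open>c\<close>, and \<open>Chain j\<close> has seen \<open>j\<close> of the initial increments.  Program
  words have the form \<open>Inc 0 \<dots> Inc 0, Tst 1, v\<close>, so that \<open>Tst 1\<close> ends the input.
\<close>

datatype node = Start | Accept | End | Control nat | Member bool nat | Chain nat

datatype label = Hash | Dollar | Instr instr | Anchor node

primrec arity :: "node \<Rightarrow> nat" where
  "arity Start = 0"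
| "arity Accept = 0"
| "arity End = 0"
| "arity (Control k) = 0"
| "arity (Member b c) = 1"
| "arity (Chain j) = 0"

text \<open>
  The chain states have the indices \<open>3 * j\<close>, so that a chain of length \<open>n\<close> consists of \<open>n\<close> blocks of
  three orbits, in which all other states find a place.
\<close>

primrec node_index :: "node \<Rightarrow> nat" where
  "node_index Start = 2"
| "node_index Accept = 5"
| "node_index End = 8"
| "node_index (Control k) = 3 * k + 11"
| "node_index (Member b c) = 3 * (2 * c + of_bool b) + 1"
| "node_index (Chain j) = 3 * j"

primrec instr_index :: "instr \<Rightarrow> nat" where
  "instr_index (Inc c) = 3 * c"
| "instr_index (Dec c) = 3 * c + 1"
| "instr_index (Tst c) = 3 * c + 2"

text \<open>The even numbers are left to the anchors: the anchor letter of state orbit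
  \<open>i\<close> is letter orbit \<open>2 * i\<close>, which keeps the numbers in a block linear
  in its position.\<close>

primrec label_index :: "label \<Rightarrow> nat" where
  "label_index Hash = 1"
| "label_index Dollar = 3"
| "label_index (Instr i) = 2 * instr_index i + 5"
| "label_index (Anchor v) = 2 * node_index v"

lemma node_index_mod: "node_index v mod 3 = (if arity v = 1 then 1 else if \<exists>j. v = Chain j then 0 else 2)"
  by (cases v) (simp_all, presburger+)

lemma inj_node_index: "inj node_index"
proof (rule injI)
  fix v w assume eq: "node_index v = node_index w"
  then have "node_index v mod 3 = node_index w mod 3" by simp
  with eq show "v = w"
    unfolding node_index_mod by (cases v; cases w) (auto split: if_splits, (presburger | (auto simp: of_bool_def split: if_splits; presburger))+)
qed

lemma inj_instr_index: "inj instr_index"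
proof (rule injI)
  fix i j assume eq: "instr_index i = instr_index j"
  then show "i = j" by (cases i; cases j; simp; presburger)
qed

lemma inj_label_index: "inj label_index"
proof (rule injI)
  fix l m assume eq: "label_index l = label_index m"
  then have "label_index l mod 2 = label_index m mod 2" by simp
  with eq show "l = m"
    by (cases l; cases m) (simp_all add: inj_eq[OF inj_node_index] inj_eq[OF inj_instr_index], presburger+)
qed

text \<open>Surjectivity ensures that every state orbit of the presentation belongs to a node and so
  has an anchor, as residuality demands.\<close>

lemma ex_node_index: "\<exists>v. node_index v = i"
proof -
  consider j where "i = 3 * j" | c where "i = 3 * (2 * c) + 1" | c where "i = 3 * (2 * c + 1) + 1"
    | "i = 2" | "i = 5" | "i = 8" | k where "i = 3 * k + 11"
  proof -
    have "\<exists>j c k. i = 3 * j \<or> i = 3 * (2 * c) + 1 \<or> i = 3 * (2 * c + 1) + 1 \<or> i = 2 \<or> i = 5 \<or> i = 8 \<or> i = 3 * k + 11"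
      by presburger
    then show ?thesis using that by blast
  qed
  then show ?thesis
  proof cases
    case 1 then show ?thesis by (intro exI[of _ "Chain j"]) simp
  next
    case 2 then show ?thesis by (intro exI[of _ "Member False c"]) simp
  next
    case 3 then show ?thesis by (intro exI[of _ "Member True c"]) simp
  next
    case 4 then show ?thesis by (intro exI[of _ Start]) simp
  next
    case 5 then show ?thesis by (intro exI[of _ Accept]) simp
  next
    case 6 then show ?thesis by (intro exI[of _ End]) simp
  next
    case 7 then show ?thesis by (intro exI[of _ "Control k"]) simp
  qed
qed

type_synonym nstate = "node \<times> atom list"
type_synonym nletter = "label \<times> atom list"

definition perm_act :: "atom perm \<Rightarrow> 'a \<times> atom list \<Rightarrow> 'a \<times> atom list" where
  "perm_act \<pi> = (\<lambda>(v, x). (v, map (apply \<pi>) x))"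

lemma perm_act_simp [simp]: "perm_act \<pi> (v, x) = (v, map (apply \<pi>) x)"
  by (simp add: perm_act_def)

definition instr_word :: "(instr \<times> atom) list \<Rightarrow> nletter list" where
  "instr_word w = map (\<lambda>(i, a). (Instr i, [a])) w"

lemma instr_word_simps [simp]:
  "instr_word [] = []"
  "instr_word ((i, a) # w) = (Instr i, [a]) # instr_word w"
  by (simp_all add: instr_word_def)

text \<open>With \<open>d\<close> input increments to come, the input is too long or too short.\<close>

primrec chain_fault :: "nat \<Rightarrow> instr list \<Rightarrow> bool" where
  "chain_fault d [] = False"
| "chain_fault d (i # w) \<longleftrightarrow>
     (i = Inc 0 \<and> (d = 0 \<or> chain_fault (d - 1) w)) \<or> (i = Tst 1 \<and> d > 0)"

section \<open>Symbolic form of the two automata: transitions and accepted words\<close>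

lemma ex_apply_eq: "\<exists>\<pi>. apply \<pi> 0 = (a :: nat)"
  using perm_extend[of "[0]" "[a]"] by auto

lemma ex_apply_eq2: "a \<noteq> b \<Longrightarrow> \<exists>\<pi>. apply \<pi> 0 = (a :: nat) \<and> apply \<pi> 1 = b"
  using perm_extend[of "[0, 1]" "[a, b]"] by auto

declare split_paired_Ex [simp del] split_paired_All [simp del]

lemma mem_lquot: "v \<in> lquot w L \<longleftrightarrow> w @ v \<in> L"
  by (simp add: lquot_def)

text \<open>\<open>L\<close> is the language of program words, \<open>h\<close> numbers its
  quotients to name the \<open>Control\<close> states, and \<open>K\<close> bounds the counters to
  be guessed.\<close>

locale gadget =
  fixes Is :: "instr set" and L :: "instr list set" and h :: "instr list set \<Rightarrow> nat" and K :: nat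
  assumes finite_Is: "finite Is"
    and finite_quot: "finite (range (\<lambda>w. lquot w L))"
    and inj_h: "inj_on h (range (\<lambda>w. lquot w L))"
    and counter_Is: "i \<in> Is \<Longrightarrow> counter i < K"
    and input_Is: "Inc 0 \<in> Is" "Tst 1 \<in> Is"
    and L_Is: "L \<subseteq> lists Is"
begin

definition quot :: "instr list set set" where
  "quot = range (\<lambda>w. lquot w L)"

lemma L_quot: "L \<in> quot"
  unfolding quot_def by (rule range_eqI[of _ _ "[]"]) (simp add: lquot_def)

lemma lquot_quot: "q \<in> quot \<Longrightarrow> lquot w q \<in> quot"
  by (auto simp: quot_def lquot_lquot)

lemma h_eq: "p \<in> quot \<Longrightarrow> q \<in> quot \<Longrightarrow> h p = h q \<longleftrightarrow> p = q"
  using inj_h by (simp add: quot_def inj_on_eq_iff)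

text \<open>These transitions are independent of the input. They are orbit representatives: the
  atoms 0 and 1 cover both equality types of two atoms. Letters without data carry a dummy atom, so
  that all letter orbits have the same shape.\<close>

inductive template :: "nstate \<Rightarrow> nletter \<Rightarrow> nstate \<Rightarrow> bool" where
  "template (Start, []) (Hash, [0]) (Control (h L), [])"
| "template (Start, []) (Hash, [0]) (Chain 0, [])"
| "c < K \<Longrightarrow> x \<le> 1 \<Longrightarrow> template (Start, []) (Hash, [0]) (Member False c, [x])"
| "i \<in> Is \<Longrightarrow> template (Accept, []) (Instr i, [0]) (Accept, [])"
| "template (Accept, []) (Dollar, [0]) (End, [])"
| "q \<in> quot \<Longrightarrow> i \<in> Is \<Longrightarrow>
     template (Control (h q), []) (Instr i, [0]) (Control (h (lquot [i] q)), [])"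
| "q \<in> quot \<Longrightarrow> [] \<notin> q \<Longrightarrow> template (Control (h q), []) (Dollar, [0]) (End, [])"
| "c < K \<Longrightarrow> i \<in> Is \<Longrightarrow> x \<le> 1 \<Longrightarrow> track c b (x = 0) i = None \<Longrightarrow>
     template (Member b c, [0]) (Instr i, [x]) (Accept, [])"
| "c < K \<Longrightarrow> i \<in> Is \<Longrightarrow> x \<le> 1 \<Longrightarrow> track c b (x = 0) i = Some b' \<Longrightarrow>
     template (Member b c, [0]) (Instr i, [x]) (Member b' c, [0])"

text \<open>The flag \<open>z\<close> distinguishes the two automata.\<close>

inductive edge :: "nat \<Rightarrow> bool \<Rightarrow> nstate \<Rightarrow> nletter \<Rightarrow> nstate \<Rightarrow> bool" for n z where
  "template s l t \<Longrightarrow> edge n z s l t"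
| "j < n \<Longrightarrow> edge n z (Chain j, []) (Instr (Inc 0), [0]) (Chain (Suc j), [])"
| "j < n \<Longrightarrow> edge n z (Chain j, []) (Instr (Tst 1), [0]) (Accept, [])"
| "edge n z (Chain n, []) (Instr (Inc 0), [0]) (Accept, [])"
| "node_index v \<le> 3 * n \<Longrightarrow>
     edge n z (Start, []) (Anchor v, [0]) (v, replicate (arity v) 0)"
| "z \<Longrightarrow> edge n z (Start, []) (Hash, [0]) (Accept, [])"

definition tr :: "nat \<Rightarrow> bool \<Rightarrow> nstate \<Rightarrow> nletter \<Rightarrow> nstate \<Rightarrow> bool" where
  "tr n z s l t \<longleftrightarrow> (\<exists>\<pi> s' l' t'. edge n z s' l' t' \<and>
     s = perm_act \<pi> s' \<and> l = perm_act \<pi> l' \<and> t = perm_act \<pi> t')"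

primrec acc :: "nat \<Rightarrow> bool \<Rightarrow> nstate \<Rightarrow> nletter list \<Rightarrow> bool" where
  "acc n z s [] \<longleftrightarrow> s = (End, [])"
| "acc n z s (l # w) \<longleftrightarrow> (\<exists>t. tr n z s l t \<and> acc n z t w)"

lemma trI:
  "edge n z (p, s) (l, x) (q, t) \<Longrightarrow>
   tr n z (p, map (apply \<pi>) s) (l, map (apply \<pi>) x) (q, map (apply \<pi>) t)"
  unfolding tr_def by (metis perm_act_simp)

lemma template_Start:
  "template (Start, s) l t \<longleftrightarrow> s = [] \<and> l = (Hash, [0]) \<and>
     (t = (Control (h L), []) \<or> t = (Chain 0, []) \<or> (\<exists>c<K. \<exists>x\<le>1. t = (Member False c, [x])))"
  by (auto simp: template.simps)

lemma template_Accept: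
  "template (Accept, s) l t \<longleftrightarrow> s = [] \<and>
     ((\<exists>i\<in>Is. l = (Instr i, [0]) \<and> t = (Accept, [])) \<or> l = (Dollar, [0]) \<and> t = (End, []))"
  by (auto simp: template.simps)

lemma template_End: "\<not> template (End, s) l t"
  by (auto simp: template.simps)

lemma template_Chain: "\<not> template (Chain j, s) l t"
  by (auto simp: template.simps)

lemma template_Control:
  "template (Control k, s) l t \<longleftrightarrow> s = [] \<and> (\<exists>q\<in>quot. k = h q \<and>
     ((\<exists>i\<in>Is. l = (Instr i, [0]) \<and> t = (Control (h (lquot [i] q)), [])) \<or>
      [] \<notin> q \<and> l = (Dollar, [0]) \<and> t = (End, [])))"
  by (auto simp: template.simps)

lemma template_Member:
  "template (Member b c, s) l t \<longleftrightarrow> s = [0] \<and> c < K \<and> (\<exists>i\<in>Is. \<exists>x\<le>1. l = (Instr i, [x]) \<and>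
     (track c b (x = 0) i = None \<and> t = (Accept, []) \<or>
      (\<exists>b'. track c b (x = 0) i = Some b' \<and> t = (Member b' c, [0]))))"
  by (auto simp: template.simps)

lemmas template_cases_node =
  template_Start template_Accept template_End template_Chain template_Control template_Member

lemma edge_cases_node:
  "edge n z (Start, s) l t \<longleftrightarrow> s = [] \<and> (l = (Hash, [0]) \<and>
     (t = (Control (h L), []) \<or> t = (Chain 0, []) \<or> (\<exists>c<K. \<exists>x\<le>1. t = (Member False c, [x])) \<or>
      z \<and> t = (Accept, [])) \<or>
     (\<exists>v. node_index v \<le> 3 * n \<and> l = (Anchor v, [0]) \<and> t = (v, replicate (arity v) 0)))"
  "edge n z (Accept, s) l t \<longleftrightarrow> template (Accept, s) l t"
  "\<not> edge n z (End, s) l t"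
  "edge n z (Control k, s) l t \<longleftrightarrow> template (Control k, s) l t"
  "edge n z (Member b c, s) l t \<longleftrightarrow> template (Member b c, s) l t"
  "edge n z (Chain j, s) l t \<longleftrightarrow> s = [] \<and>
     (j < n \<and> l = (Instr (Inc 0), [0]) \<and> t = (Chain (Suc j), []) \<or>
      j < n \<and> l = (Instr (Tst 1), [0]) \<and> t = (Accept, []) \<or>
      j = n \<and> l = (Instr (Inc 0), [0]) \<and> t = (Accept, []))"
  by (subst edge.simps; auto simp: template_cases_node)+

lemma tr_edge:
  "edge n z (p, []) (l, [0]) (q, replicate k 0) \<Longrightarrow> tr n z (p, []) (l, [a]) (q, replicate k a)"
  using ex_apply_eq[of a] trI[of n z p "[]" l "[0]" q "replicate k 0"] by auto

lemma tr_edge_0: "edge n z (p, []) (l, [0]) (q, []) \<Longrightarrow> tr n z (p, []) (l, [a]) (q, [])"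
  using tr_edge[of n z p l q 0 a] by simp

lemma tr_cases:
  assumes "tr n z (p, s) (l, x) t"
  obtains \<pi> s' x' t' where "edge n z (p, s') (l, x') t'"
    "s = map (apply \<pi>) s'" "x = map (apply \<pi>) x'" "t = perm_act \<pi> t'"
proof -
  from assms obtain \<pi> s' l' t' where e: "edge n z s' l' t'"
    "(p, s) = perm_act \<pi> s'" "(l, x) = perm_act \<pi> l'" "t = perm_act \<pi> t'"
    unfolding tr_def by blast
  then show ?thesis
    using that[of "snd s'" "snd l'" t' \<pi>] by (cases s'; cases l') auto
qed

lemma le_1_iff: "x \<le> 1 \<longleftrightarrow> x = 0 \<or> x = (1 :: nat)"
  by auto

lemma tr_Start_Hash:
  "tr n z (Start, []) (Hash, [a]) t \<longleftrightarrow>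
     t = (Control (h L), []) \<or> t = (Chain 0, []) \<or> (\<exists>c<K. \<exists>x. t = (Member False c, [x])) \<or>
     z \<and> t = (Accept, [])"
proof
  assume "tr n z (Start, []) (Hash, [a]) t"
  then show "t = (Control (h L), []) \<or> t = (Chain 0, []) \<or> (\<exists>c<K. \<exists>x. t = (Member False c, [x])) \<or>
     z \<and> t = (Accept, [])"
    by (rule tr_cases) (auto simp: edge_cases_node)
next
  have member: "tr n z (Start, []) (Hash, [a]) (Member False c, [x])" if "c < K" for c x
  proof -
    \<comment> \<open>The representative \<open>x'\<close> is 0 if \<open>x = a\<close> and 1
      otherwise.\<close>
    obtain \<pi> x' where \<pi>: "x' \<le> 1" "apply \<pi> 0 = a" "apply \<pi> x' = x"
      using ex_apply_eq[of a] ex_apply_eq2[of a x] by (cases "x = a") (fastforce simp: le_1_iff)+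
    have "edge n z (Start, []) (Hash, [0]) (Member False c, [x'])"
      using that \<pi>(1) by (intro edge.intros template.intros)
    from trI[OF this, of \<pi>] show ?thesis by (simp add: \<pi>)
  qed
  assume "t = (Control (h L), []) \<or> t = (Chain 0, []) \<or> (\<exists>c<K. \<exists>x. t = (Member False c, [x])) \<or>
     z \<and> t = (Accept, [])"
  then show "tr n z (Start, []) (Hash, [a]) t"
    by (elim disjE exE conjE) (auto intro!: tr_edge_0 member simp: edge_cases_node)
qed

lemma tr_Start_Anchor:
  "node_index v \<le> 3 * n \<Longrightarrow>
   tr n z (Start, []) (Anchor v, [a]) t \<longleftrightarrow> t = (v, replicate (arity v) a)"
  by (auto simp: edge_cases_node elim!: tr_cases intro!: tr_edge)

lemma tr_Accept:
  "tr n z (Accept, []) l t \<longleftrightarrow>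
     (\<exists>i\<in>Is. \<exists>a. l = (Instr i, [a]) \<and> t = (Accept, [])) \<or> (\<exists>a. l = (Dollar, [a]) \<and> t = (End, []))"
  by (cases l) (auto simp: edge_cases_node template_cases_node elim!: tr_cases intro!: tr_edge_0)

lemma tr_Control_Instr:
  "q \<in> quot \<Longrightarrow> i \<in> Is \<Longrightarrow>
   tr n z (Control (h q), []) (Instr i, [a]) t \<longleftrightarrow> t = (Control (h (lquot [i] q)), [])"
  by (auto simp: edge_cases_node template_cases_node h_eq elim!: tr_cases intro!: tr_edge_0)

lemma tr_Control_Dollar:
  "q \<in> quot \<Longrightarrow> tr n z (Control (h q), []) (Dollar, [a]) t \<longleftrightarrow> [] \<notin> q \<and> t = (End, [])"
  by (auto simp: edge_cases_node template_cases_node h_eq elim!: tr_cases intro!: tr_edge_0)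

lemma tr_Member_Instr:
  assumes "c < K" "i \<in> Is"
  shows "tr n z (Member b c, [x]) (Instr i, [a]) t \<longleftrightarrow>
    t = (case track c b (a = x) i of None \<Rightarrow> (Accept, []) | Some b' \<Rightarrow> (Member b' c, [x]))"
proof
  assume "tr n z (Member b c, [x]) (Instr i, [a]) t"
  then obtain \<pi> x' t' where *: "x = apply \<pi> 0" "a = apply \<pi> x'" "t = perm_act \<pi> t'"
    "template (Member b c, [0]) (Instr i, [x']) t'"
    by (auto simp: edge_cases_node template_cases_node elim!: tr_cases)
  \<comment> \<open>Permutations are injective, so the representative has the same equality type as
    the actual atoms.\<close>
  then have "x' = 0 \<longleftrightarrow> a = x" by (simp add: apply_inj)
  with * show "t = (case track c b (a = x) i of None \<Rightarrow> (Accept, []) | Some b' \<Rightarrow> (Member b' c, [x]))"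
    by (auto simp: template_cases_node)
next
  obtain \<pi> x' where \<pi>: "x' \<le> 1" "apply \<pi> 0 = x" "apply \<pi> x' = a"
    using ex_apply_eq[of x] ex_apply_eq2[of x a] by (cases "x = a") (fastforce simp: le_1_iff)+
  then have x': "x' = 0 \<longleftrightarrow> a = x" by (metis apply_inj)
  assume t: "t = (case track c b (a = x) i of None \<Rightarrow> (Accept, []) | Some b' \<Rightarrow> (Member b' c, [x]))"
  show "tr n z (Member b c, [x]) (Instr i, [a]) t"
  proof (cases "track c b (a = x) i")
    case None
    then have "edge n z (Member b c, [0]) (Instr i, [x']) (Accept, [])"
      using assms \<pi>(1) x' by (simp add: edge_cases_node template_cases_node)
    from trI[OF this, of \<pi>] show ?thesis by (simp add: \<pi> t None)
  next
    case (Some b')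
    then have "edge n z (Member b c, [0]) (Instr i, [x']) (Member b' c, [0])"
      using assms \<pi>(1) x' by (simp add: edge_cases_node template_cases_node)
    from trI[OF this, of \<pi>] show ?thesis by (simp add: \<pi> t Some)
  qed
qed

lemma tr_Member_Dollar: "\<not> tr n z (Member b c, s) (Dollar, a) t"
  by (auto simp: edge_cases_node template_cases_node elim!: tr_cases)

lemma tr_Chain:
  "tr n z (Chain j, []) l t \<longleftrightarrow> (\<exists>a.
     j < n \<and> l = (Instr (Inc 0), [a]) \<and> t = (Chain (Suc j), []) \<or>
     j < n \<and> l = (Instr (Tst 1), [a]) \<and> t = (Accept, []) \<or>
     j = n \<and> l = (Instr (Inc 0), [a]) \<and> t = (Accept, []))"
  by (cases l) (auto simp: edge_cases_node elim!: tr_cases intro!: tr_edge_0)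

lemma tr_End: "\<not> tr n z (End, s) l t"
  by (cases l) (auto simp: edge_cases_node elim!: tr_cases)

lemma acc_Accept: "w \<in> lists (Is \<times> UNIV) \<Longrightarrow> acc n z (Accept, []) (instr_word w @ [(Dollar, [a])])"
  by (induction w) (auto simp: tr_Accept)

lemma acc_AcceptD:
  "acc n z (Accept, []) v \<Longrightarrow> \<exists>w\<in>lists (Is \<times> UNIV). \<exists>a. v = instr_word w @ [(Dollar, [a])]"
proof (induction v)
  case (Cons l v)
  then obtain t where t: "tr n z (Accept, []) l t" "acc n z t v" by auto
  then consider i a where "i \<in> Is" "l = (Instr i, [a])" "t = (Accept, [])"
    | a where "l = (Dollar, [a])" "t = (End, [])"
    by (auto simp: tr_Accept)
  then show ?case
  proof cases
    case 1
    then obtain w a' where "w \<in> lists (Is \<times> UNIV)" "v = instr_word w @ [(Dollar, [a'])]"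
      using Cons.IH t by auto
    with 1 show ?thesis by (intro bexI[of _ "(i, a) # w"]) auto
  next
    case 2
    then have "v = []" using t tr_End by (cases v) auto
    with 2 show ?thesis by (intro bexI[of _ "[]"]) auto
  qed
qed simp

text \<open>The deterministic automaton of quotients is complemented by enabling
  \<open>Dollar\<close> at the quotients that miss the empty word.\<close>

lemma acc_Control:
  "w \<in> lists (Is \<times> UNIV) \<Longrightarrow> q \<in> quot \<Longrightarrow>
   acc n z (Control (h q), []) (instr_word w @ [(Dollar, [a])]) \<longleftrightarrow> map fst w \<notin> q"
proof (induction w arbitrary: q)
  case (Cons ix w)
  then show ?case
    by (cases ix) (auto simp: tr_Control_Instr lquot_quot mem_lquot)
qed (simp add: tr_Control_Dollar)

text \<open>A fault leads to \<open>Accept\<close>, after which the remaining instructions are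
  irrelevant; a run without a fault is stuck at \<open>Dollar\<close>.\<close>

lemma acc_Member:
  "w \<in> lists (Is \<times> UNIV) \<Longrightarrow> c < K \<Longrightarrow>
   acc n z (Member b c, [x]) (instr_word w @ [(Dollar, [a])]) \<longleftrightarrow> fault c x b w"
proof (induction w arbitrary: b)
  case (Cons ix w)
  then show ?case
    by (cases ix) (auto simp: tr_Member_Instr acc_Accept split: option.splits)
qed (simp add: tr_Member_Dollar)

lemma acc_Chain:
  "w \<in> lists (Is \<times> UNIV) \<Longrightarrow> j \<le> n \<Longrightarrow>
   acc n z (Chain j, []) (instr_word w @ [(Dollar, [a])]) \<longleftrightarrow> chain_fault (n - j) (map fst w)"
proof (induction w arbitrary: j)
  case (Cons ix w)
  obtain i x where ix: "ix = (i, x)" by (cases ix)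
  have accept: "acc n z (Accept, []) (instr_word w @ [(Dollar, [a])])"
    using Cons.prems(1) by (intro acc_Accept) simp
  show ?case
  proof (cases "j < n")
    case True
    then have "n - Suc j = n - j - 1" "n - j > 0" by auto
    with Cons True show ?thesis
      by (auto simp: ix tr_Chain accept)
  next
    case False
    with Cons.prems show ?thesis by (auto simp: ix tr_Chain accept)
  qed
qed (simp add: tr_Chain)

text \<open>The disjuncts are errors of control, of the input and of the data.\<close>

definition rejected :: "nat \<Rightarrow> (instr \<times> atom) list \<Rightarrow> bool" where
  "rejected n w \<longleftrightarrow> map fst w \<notin> L \<or> chain_fault n (map fst w) \<or> (\<exists>c<K. \<exists>x. fault c x False w)"

lemma acc_Start_Hash:
  assumes "w \<in> lists (Is \<times> UNIV)"
  shows "acc n z (Start, []) ((Hash, [b]) # instr_word w @ [(Dollar, [a])]) \<longleftrightarrow> z \<or> rejected n w"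
proof -
  let ?v = "instr_word w @ [(Dollar, [a])]"
  have "acc n z (Start, []) ((Hash, [b]) # ?v) \<longleftrightarrow>
      acc n z (Control (h L), []) ?v \<or> acc n z (Chain 0, []) ?v \<or>
      (\<exists>c<K. \<exists>x. acc n z (Member False c, [x]) ?v) \<or> z \<and> acc n z (Accept, []) ?v"
    unfolding acc.simps tr_Start_Hash by blast
  then show ?thesis
    unfolding rejected_def acc_Control[OF assms L_quot] acc_Chain[OF assms le0]
    using acc_Accept[OF assms] acc_Member[OF assms] by auto
qed

lemma tr_True: "tr n True s l t \<longleftrightarrow>
  tr n False s l t \<or> s = (Start, []) \<and> (\<exists>a. l = (Hash, [a])) \<and> t = (Accept, [])"
proof -
  have edge: "edge n True s l t \<longleftrightarrow> edge n False s l t \<or> s = (Start, []) \<and> l = (Hash, [0]) \<and> t = (Accept, [])"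
    for s l t by (simp add: edge.simps)
  have "tr n True s l t \<longleftrightarrow> tr n False s l t \<or>
      (\<exists>\<pi>. s = perm_act \<pi> (Start, []) \<and> l = perm_act \<pi> (Hash, [0]) \<and> t = perm_act \<pi> (Accept, []))"
    unfolding tr_def edge by blast
  also have "(\<exists>\<pi>. s = perm_act \<pi> (Start, []) \<and> l = perm_act \<pi> (Hash, [0]) \<and> t = perm_act \<pi> (Accept, []))
      \<longleftrightarrow> s = (Start, []) \<and> (\<exists>a. l = (Hash, [a])) \<and> t = (Accept, [])"
    using ex_apply_eq by (simp, metis)
  finally show ?thesis .
qed

lemma acc_mono: "acc n False s w \<Longrightarrow> acc n True s w"
  by (induction w arbitrary: s) (auto simp: tr_True)

text \<open>The extra edge contributes only words made of \<open>Hash\<close>, instructions and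
  \<open>Dollar\<close>. If all instruction words are rejected, the guesses made at
  \<open>Hash\<close> accept these words already.\<close>

lemma acc_eq_if_rejected:
  assumes "\<And>w. w \<in> lists (Is \<times> UNIV) \<Longrightarrow> rejected n w"
  shows "acc n True s v \<longleftrightarrow> acc n False s v"
proof
  show "acc n True s v \<Longrightarrow> acc n False s v"
  proof (induction v arbitrary: s)
    case (Cons l v)
    then obtain t where t: "tr n True s l t" "acc n False t v" by auto
    show ?case
    proof (cases "tr n False s l t")
      case False
      then obtain b where b: "s = (Start, [])" "l = (Hash, [b])" "t = (Accept, [])"
        using t(1) by (auto simp: tr_True)
      then obtain w a where "w \<in> lists (Is \<times> UNIV)" "v = instr_word w @ [(Dollar, [a])]"
        using t(2) acc_AcceptD by metis
      then show ?thesis using acc_Start_Hash[of w n False b a] assms b by simp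
    qed (use t in auto)
  qed simp
qed (rule acc_mono)

lemma acc_eq_iff:
  "(\<forall>v. acc n True (Start, []) v \<longleftrightarrow> acc n False (Start, []) v) \<longleftrightarrow>
   (\<forall>w\<in>lists (Is \<times> UNIV). rejected n w)"
  using acc_Start_Hash acc_eq_if_rejected by metis

end

section \<open>Program words with a unary input\<close>

lemma replicate_in_star: "replicate j x \<in> star {[x]}"
proof (induction j)
  case (Suc j)
  then show ?case using star.append[of "[x]" "{[x]}" "replicate j x"] by simp
qed (simp add: star.Nil)

lemma star_single: "star {[x]} = range (\<lambda>j. replicate j x)"
proof -
  have "\<exists>j. w = replicate j x" if "w \<in> star {[x]}" for w
    using that
  proof (induction rule: star.induct)
    case (append u v)
    then obtain j where "u @ v = replicate (Suc j) x" by auto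
    then show ?case by blast
  qed auto
  then show ?thesis using replicate_in_star by fast
qed

definition input_words :: "instr list set \<Rightarrow> instr list set" where
  "input_words R = conc (star {[Inc 0]}) (conc {[Tst 1]} R)"

lemma mem_input_words:
  "u \<in> input_words R \<longleftrightarrow> (\<exists>j. \<exists>v\<in>R. u = replicate j (Inc 0) @ Tst 1 # v)"
  by (auto simp: input_words_def star_single conc_def)

lemma regular_input_words: "regular R \<Longrightarrow> regular (input_words R)"
  unfolding input_words_def by (intro regular_conc regular_star regular_single)

lemma run_replicate_Inc: "run (replicate n (Inc c)) s = {s(c := s c + n)}"
  by (induction n arbitrary: s) auto

text \<open>Counter 1 is still zero after the input, so \<open>Tst 1\<close> succeeds and acts as a
  mere separator.\<close>

lemma run_input: "run (replicate n (Inc 0) @ Tst 1 # v) (\<lambda>c. 0) = run v ((\<lambda>c. 0)(0 := n))"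
  by (simp add: run_append seq_def run_replicate_Inc)

text \<open>With too few increments \<open>Tst 1\<close> comes while some are outstanding; with too
  many an \<open>Inc 0\<close> comes at \<open>d = 0\<close>. The check ends at the first
  \<open>Tst 1\<close>, so \<open>v\<close> has no influence.\<close>

lemma chain_fault_input: "chain_fault n (replicate j (Inc 0) @ Tst 1 # v) \<longleftrightarrow> j \<noteq> n"
proof (induction j arbitrary: n)
  case (Suc j)
  then show ?case by (cases n) auto
qed auto

context gadget
begin

text \<open>A word escapes rejection iff it is a program word with exactly \<open>n\<close> input
  increments whose atoms show no fault. A program word can be given such atoms iff it is executable
  from empty counters.\<close>

lemma all_rejected_iff:
  assumes L: "L = input_words R"
  shows "(\<forall>w\<in>lists (Is \<times> UNIV). rejected n w) \<longleftrightarrow> sem R ((\<lambda>c. 0)(0 := n)) = {}"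
proof
  assume rej: "\<forall>w\<in>lists (Is \<times> UNIV). rejected n w"
  show "sem R ((\<lambda>c. 0)(0 := n)) = {}"
  proof (rule ccontr)
    assume "sem R ((\<lambda>c. 0)(0 := n)) \<noteq> {}"
    then obtain v where v: "v \<in> R" "run v ((\<lambda>c. 0)(0 := n)) \<noteq> {}"
      by (auto simp: sem_def)
    let ?u = "replicate n (Inc 0) @ Tst 1 # v"
    have "run ?u (\<lambda>c. card {}) \<noteq> {}"
      using v(2) unfolding card.empty run_input .
    then obtain w where w: "map fst w = ?u" "\<forall>c x. \<not> fault c x (x \<in> {}) w"
      using ex_faultless[of ?u "\<lambda>c. {}"] by auto
    have "?u \<in> L" using v(1) L mem_input_words by blast
    then have "map fst w \<in> lists Is" using L_Is w(1) by auto
    then have "w \<in> lists (Is \<times> UNIV)" by (auto simp: in_lists_conv_set)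
    with rej have "rejected n w" by blast
    moreover have "map fst w \<in> L" "\<not> chain_fault n (map fst w)"
      using \<open>?u \<in> L\<close> unfolding w(1) chain_fault_input by auto
    ultimately show False
      using w(2) by (auto simp: rejected_def)
  qed
next
  assume empty: "sem R ((\<lambda>c. 0)(0 := n)) = {}"
  show "\<forall>w\<in>lists (Is \<times> UNIV). rejected n w"
  proof (rule ballI, rule ccontr)
    fix w assume w: "w \<in> lists (Is \<times> UNIV)" "\<not> rejected n w"
    then have "map fst w \<in> L"
      unfolding rejected_def by blast
    then obtain j v where v: "v \<in> R" "map fst w = replicate j (Inc 0) @ Tst 1 # v"
      unfolding L mem_input_words by blast
    have "j = n" using w(2) unfolding rejected_def v(2) chain_fault_input by blast
    \<comment> \<open>All counters of \<open>w\<close> are below \<open>K\<close>, so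
      \<open>rejected\<close> has covered each of them.\<close>
    have "\<not> fault c x (x \<in> {}) w" if "c \<in> counter ` fst ` set w" for c x
      using that w counter_Is by (auto simp: rejected_def in_lists_conv_set)
    then have "run (map fst w) (\<lambda>c. card {}) \<noteq> {}"
      using run_if_faultless[of w "\<lambda>c. {}"] by auto
    then have "run v ((\<lambda>c. 0)(0 := n)) \<noteq> {}"
      unfolding card.empty v(2) \<open>j = n\<close> run_input .
    then show False
      using empty v(1) by (auto simp: sem_def)
  qed
qed

end

section \<open>Presentations of the automata\<close>

definition anchor :: "nat \<Rightarrow> atom list \<Rightarrow> elem_pres \<times> elem_pres \<times> elem_pres" where
  "anchor i x = ((2, []), (2 * i, [0]), (i, x))"

text \<open>Block \<open>j\<close> anchors three state orbits and adds the two edges from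
  \<open>Chain j\<close> that exist for \<open>j < n\<close>. States 2 and 5 are
  \<open>Start\<close> and \<open>Accept\<close>; letters 5 and 15 are \<open>Inc 0\<close> and
  \<open>Tst 1\<close>.\<close>

primrec add_blocks :: "nat \<Rightarrow> (elem_pres \<times> elem_pres \<times> elem_pres) list \<Rightarrow>
    (elem_pres \<times> elem_pres \<times> elem_pres) list" where
  "add_blocks 0 T = T"
| "add_blocks (Suc j) T =
     anchor (3 * j) [] # anchor (3 * j + 1) [0] # anchor (3 * j + 2) [] #
     ((3 * j, []), (5, [0]), (3 * j + 3, [])) # ((3 * j, []), (15, [0]), (5, [])) # add_blocks j T"

definition all_edges where
  "all_edges n z T =
     (if z then [((2, []), (1, [0]), (5, []))] else []) @
     ((3 * n, []), (5, [0]), (5, [])) # anchor (3 * n) [] # add_blocks n T"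

primrec state_orbits :: "nat \<Rightarrow> set_pres" where
  "state_orbits 0 = [(0, [[]])]"
| "state_orbits (Suc n) = (0, [[]]) # (1, [[0]]) # (0, [[]]) # state_orbits n"

text \<open>The state orbits end at \<open>3 * n\<close>, hence the anchors end at
  \<open>6 * n\<close>.\<close>

definition letter_orbits :: "nat \<Rightarrow> set_pres" where
  "letter_orbits n = replicate (Suc (6 * n)) (1, [[0]])"

definition presentation where
  "presentation n z T =
     \<lparr>alphabet_pres = letter_orbits n, states_pres = state_orbits n, initial_pres = [(2, [])],
      final_pres = [(8, [])], transitions_pres = all_edges n z T\<rparr>"

definition anchor_of :: "nat \<Rightarrow> elem_pres \<times> elem_pres \<times> elem_pres" where
  "anchor_of i = anchor i (if i mod 3 = 1 then [0] else [])"

lemma set_add_blocks: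
  "set (add_blocks n T) = set T \<union> anchor_of ` {..<3 * n} \<union>
     (\<Union>j<n. {((3 * j, []), (5, [0]), (3 * j + 3, [])), ((3 * j, []), (15, [0]), (5, []))})"
proof (induction n)
  case (Suc n)
  have "{..<3 * Suc n} = {3 * n, 3 * n + 1, 3 * n + 2} \<union> {..<3 * n}"
    by auto
  moreover have "3 * n mod 3 = 0" "(3 * n + 1) mod 3 = 1" "(3 * n + 2) mod 3 = 2"
    by presburger+
  then have "anchor_of (3 * n) = anchor (3 * n) []" "anchor_of (3 * n + 1) = anchor (3 * n + 1) [0]"
    "anchor_of (3 * n + 2) = anchor (3 * n + 2) []"
    unfolding anchor_of_def by simp_all
  ultimately show ?case
    unfolding add_blocks.simps list.set Suc.IH lessThan_Suc by (simp only: image_Un image_insert image_empty) blast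
qed simp

lemma length_state_orbits: "length (state_orbits n) = Suc (3 * n)"
  by (induction n) auto

lemma nth_state_orbits:
  "i \<le> 3 * n \<Longrightarrow> state_orbits n ! i = (if i mod 3 = 1 then (1, [[0]]) else (0, [[]]))"
proof (induction n arbitrary: i)
  case (Suc n)
  consider "i = 0" | "i = 1" | "i = 2" | k where "i = Suc (Suc (Suc k))"
    by (metis One_nat_def not0_implies_Suc numeral_2_eq_2)
  then show ?case
  proof cases
    case 4
    have "i mod 3 = k mod 3" unfolding 4 by presburger
    with 4 Suc show ?thesis by simp
  qed auto
qed simp

lemma length_letter_orbits: "length (letter_orbits n) = Suc (6 * n)"
  by (simp add: letter_orbits_def)

lemma nth_letter_orbits: "i \<le> 6 * n \<Longrightarrow> letter_orbits n ! i = (1, [[0]])"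
  by (simp add: letter_orbits_def del: replicate_Suc)

lemma wf_orbits: "\<forall>r\<in>set (state_orbits n). wf_orbit r" "\<forall>r\<in>set (letter_orbits n). wf_orbit r"
  by (induction n) (auto simp: wf_orbit_def letter_orbits_def)

lemma wf_elem_state: "wf_elem (state_orbits n) (i, t) \<longleftrightarrow>
    i \<le> 3 * n \<and> length t = (if i mod 3 = 1 then 1 else 0)"
  by (auto simp: wf_elem_def length_state_orbits nth_state_orbits less_Suc_eq_le length_Suc_conv)

lemma wf_elem_letter: "wf_elem (letter_orbits n) (i, t) \<longleftrightarrow> i \<le> 6 * n \<and> length t = 1"
  by (auto simp: wf_elem_def length_letter_orbits nth_letter_orbits less_Suc_eq_le length_Suc_conv)

text \<open>All groups in these presentations are trivial, so each class contains a single
  tuple.\<close>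

definition single :: "elem_pres \<Rightarrow> nat \<times> atom list set" where
  "single = (\<lambda>(i, t). (i, {t}))"

lemma inj_single: "inj single"
  by (auto simp: inj_def single_def)

lemma elem_state: "wf_elem (state_orbits n) e \<Longrightarrow> elem (state_orbits n) e = single e"
  by (cases e) (auto simp: wf_elem_state elem_def nth_state_orbits single_def length_Suc_conv)

lemma elem_letter: "wf_elem (letter_orbits n) e \<Longrightarrow> elem (letter_orbits n) e = single e"
  by (cases e) (auto simp: wf_elem_letter elem_def nth_letter_orbits single_def length_Suc_conv)

lemma elem_act_single: "elem_act \<pi> (single e) = single (perm_act \<pi> e)"
  by (cases e) (simp add: single_def elem_act_def)

definition state_code :: "nstate \<Rightarrow> elem_pres" where
  "state_code = (\<lambda>(v, x). (node_index v, x))"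

definition letter_code :: "nletter \<Rightarrow> elem_pres" where
  "letter_code = (\<lambda>(l, x). (label_index l, x))"

lemma inj_state_code: "inj state_code"
  using inj_node_index by (auto simp: inj_def state_code_def)

lemma inj_letter_code: "inj letter_code"
  using inj_label_index by (auto simp: inj_def letter_code_def)

lemma perm_act_state_code: "perm_act \<pi> (state_code s) = state_code (perm_act \<pi> s)"
  by (cases s) (simp add: state_code_def)

lemma perm_act_letter_code: "perm_act \<pi> (letter_code l) = letter_code (perm_act \<pi> l)"
  by (cases l) (simp add: letter_code_def)

lemma arity_node_index: "arity v = (if node_index v mod 3 = 1 then 1 else 0)"
  unfolding node_index_mod by (cases v) auto

text \<open>Since \<open>n\<close> exceeds all orbit numbers in \<open>T\<close>, the
  \<open>n\<close> blocks provide every orbit that the templates use.\<close>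

locale coded_gadget = gadget +
  fixes T :: "(elem_pres \<times> elem_pres \<times> elem_pres) list" and n :: nat
  assumes set_T: "set T = {(state_code s, letter_code l, state_code t) | s l t. template s l t}"
    and T_less: "(p, a, q) \<in> set T \<Longrightarrow> fst p < n \<and> fst a < n \<and> fst q < n"
begin

text \<open>\<open>End\<close> has number 8 and occurs in \<open>T\<close>.\<close>

lemma n_gt: "n > 8"
proof -
  have "(state_code (Accept, []), letter_code (Dollar, [0]), state_code (End, [])) \<in> set T"
    unfolding set_T using template.intros(5) by blast
  from T_less[OF this] show ?thesis by (simp add: state_code_def)
qed

lemma anchors:
  "anchor_of ` {..3 * n} =
   {(state_code (Start, []), letter_code (Anchor v, [0]), state_code (v, replicate (arity v) 0)) | v.
      node_index v \<le> 3 * n}"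
proof -
  have *: "anchor_of (node_index v) =
      (state_code (Start, []), letter_code (Anchor v, [0]), state_code (v, replicate (arity v) 0))" for v
    by (simp add: anchor_of_def anchor_def state_code_def letter_code_def arity_node_index)
  show ?thesis
    unfolding *[symmetric] using ex_node_index by (auto simp: image_iff) metis
qed

lemma set_all_edges:
  "set (all_edges n z T) = {(state_code s, letter_code l, state_code t) | s l t. edge n z s l t}"
proof -
  let ?C = "\<lambda>s l t. (state_code s, letter_code l, state_code t)"
  have "{..3 * n} = insert (3 * n) {..<3 * n}" by auto
  then have "anchor_of ` {..3 * n} = insert (anchor (3 * n) []) (anchor_of ` {..<3 * n})"
    by (simp add: anchor_of_def)
  then have "set (all_edges n z T) = {?C s l t | s l t. template s l t} \<union>
      (\<Union>j<n. {?C (Chain j, []) (Instr (Inc 0), [0]) (Chain (Suc j), []),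
               ?C (Chain j, []) (Instr (Tst 1), [0]) (Accept, [])}) \<union>
      {?C (Chain n, []) (Instr (Inc 0), [0]) (Accept, [])} \<union>
      anchor_of ` {..3 * n} \<union>
      (if z then {?C (Start, []) (Hash, [0]) (Accept, [])} else {})"
    by (auto simp: all_edges_def set_add_blocks set_T state_code_def letter_code_def add.commute)
  also have "\<dots> = {?C s l t | s l t. edge n z s l t}"
  proof (intro set_eqI iffI)
    fix e assume "e \<in> {?C s l t | s l t. edge n z s l t}"
    then obtain s l t where "edge n z s l t" "e = ?C s l t" by blast
    then show "e \<in> {?C s l t | s l t. template s l t} \<union>
      (\<Union>j<n. {?C (Chain j, []) (Instr (Inc 0), [0]) (Chain (Suc j), []),
               ?C (Chain j, []) (Instr (Tst 1), [0]) (Accept, [])}) \<union>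
      {?C (Chain n, []) (Instr (Inc 0), [0]) (Accept, [])} \<union>
      anchor_of ` {..3 * n} \<union>
      (if z then {?C (Start, []) (Hash, [0]) (Accept, [])} else {})"
      unfolding anchors by cases auto
  next
    fix e assume "e \<in> {?C s l t | s l t. template s l t} \<union>
      (\<Union>j<n. {?C (Chain j, []) (Instr (Inc 0), [0]) (Chain (Suc j), []),
               ?C (Chain j, []) (Instr (Tst 1), [0]) (Accept, [])}) \<union>
      {?C (Chain n, []) (Instr (Inc 0), [0]) (Accept, [])} \<union>
      anchor_of ` {..3 * n} \<union>
      (if z then {?C (Start, []) (Hash, [0]) (Accept, [])} else {})"
    moreover define E where "E = {?C s l t | s l t. edge n z s l t}"
    then have CE: "?C s l t \<in> E" if "edge n z s l t" for s l t
      using that by blast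
    ultimately show "e \<in> {?C s l t | s l t. edge n z s l t}"
      unfolding anchors E_def[symmetric] 
      by (auto intro!: CE intro: edge.intros edge.intros(3)[simplified] split: if_splits)
  qed
  finally show ?thesis .
qed

end

section \<open>Languages and residuality of the presented automata\<close>

lemma accepts_lists:
  assumes "transitions A \<subseteq> states A \<times> alphabet A \<times> states A" "accepts A q v"
  shows "v \<in> lists (alphabet A)"
  using assms(2)
proof (induction v arbitrary: q)
  case (Cons l v)
  then obtain q' where "(q, l, q') \<in> transitions A" "accepts A q' v" by auto
  then show ?case using assms(1) Cons.IH by auto
qed simp

context coded_gadget
begin

lemma wf_state_code:
  "wf_elem (state_orbits n) (state_code s) \<longleftrightarrow> node_index (fst s) \<le> 3 * n \<and> length (snd s) = arity (fst s)"
  by (cases s) (simp add: state_code_def wf_elem_state arity_node_index)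

lemma wf_letter_code:
  "wf_elem (letter_orbits n) (letter_code l) \<longleftrightarrow> label_index (fst l) \<le> 6 * n \<and> length (snd l) = 1"
  by (cases l) (simp add: letter_code_def wf_elem_letter)

lemma template_wf:
  assumes "template s l t"
  shows "wf_elem (state_orbits n) (state_code s) \<and> wf_elem (letter_orbits n) (letter_code l) \<and>
    wf_elem (state_orbits n) (state_code t)"
proof -
  have "(state_code s, letter_code l, state_code t) \<in> set T"
    using assms unfolding set_T by blast
  from T_less[OF this]
  have "node_index (fst s) < n" "label_index (fst l) < n" "node_index (fst t) < n"
    by (simp_all add: state_code_def letter_code_def split: prod.splits)
  moreover have "length (snd s) = arity (fst s)" "length (snd l) = 1" "length (snd t) = arity (fst t)"
    using assms by (induction rule: template.induct) auto
  ultimately show ?thesis by (simp add: wf_state_code wf_letter_code)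
qed

lemma edge_wf:
  assumes "edge n z s l t"
  shows "wf_elem (state_orbits n) (state_code s) \<and> wf_elem (letter_orbits n) (letter_code l) \<and>
    wf_elem (state_orbits n) (state_code t)"
  using assms
proof (cases rule: edge.cases)
  case 1
  then show ?thesis by (rule template_wf)
qed (use n_gt in \<open>auto simp: wf_state_code wf_letter_code\<close>)

abbreviation "pres \<equiv> \<lambda>z. presentation n z T"
abbreviation "aut \<equiv> \<lambda>z. automaton_of (pres z)"
abbreviation "sstate \<equiv> \<lambda>s. single (state_code s)"
abbreviation "sletter \<equiv> \<lambda>l. single (letter_code l)"

lemma inj_sstate: "sstate s = sstate t \<longleftrightarrow> s = t"
  using inj_single inj_state_code by (simp add: inj_eq)

lemma inj_sletter: "sletter s = sletter t \<longleftrightarrow> s = t"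
  using inj_single inj_letter_code by (simp add: inj_eq)

lemma wf_pres: "wf_pres (pres z)"
proof -
  have "case e of (p, a, q) \<Rightarrow> wf_elem (state_orbits n) p \<and> wf_elem (letter_orbits n) a \<and>
      wf_elem (state_orbits n) q" if "e \<in> set (all_edges n z T)" for e
  proof -
    from that obtain s l t where "edge n z s l t" "e = (state_code s, letter_code l, state_code t)"
      unfolding set_all_edges by blast
    then show ?thesis using edge_wf by simp
  qed
  then have "\<forall>e\<in>set (all_edges n z T). case e of (p, a, q) \<Rightarrow> wf_elem (state_orbits n) p \<and>
      wf_elem (letter_orbits n) a \<and> wf_elem (state_orbits n) q"
    by blast
  then show ?thesis
    unfolding wf_pres_def presentation_def using wf_orbits n_gt by (simp add: wf_elem_state)
qed

lemma wf_Start: "wf_elem (state_orbits n) (state_code (Start, []))"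
  and wf_End: "wf_elem (state_orbits n) (state_code (End, []))"
  using n_gt by (simp_all add: state_code_def wf_elem_state)

lemma aut_simps:
  "alphabet (aut z) = carrier_of (letter_orbits n)"
  "states (aut z) = carrier_of (state_orbits n)"
  "initial (aut z) = {sstate (Start, [])}"
  "final (aut z) = {sstate (End, [])}"
proof -
  have "(2, []) = state_code (Start, [])" "(8, []) = state_code (End, [])"
    by (simp_all add: state_code_def)
  then show "alphabet (aut z) = carrier_of (letter_orbits n)"
    "states (aut z) = carrier_of (state_orbits n)"
    "initial (aut z) = {sstate (Start, [])}"
    "final (aut z) = {sstate (End, [])}"
    by (simp_all add: automaton_of_def Let_def presentation_def elem_state wf_Start wf_End
      elem_act_single perm_act_state_code)
qed

text \<open>Coding commutes with the action of permutations, so closing the coded representatives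
  under it yields the codes of \<open>tr\<close>.\<close>

lemma transitions_aut:
  "transitions (aut z) = {(sstate s, sletter l, sstate t) | s l t. tr n z s l t}"
proof -
  have "transitions (aut z) = {(elem_act \<pi> (elem (state_orbits n) (state_code s)),
      elem_act \<pi> (elem (letter_orbits n) (letter_code l)),
      elem_act \<pi> (elem (state_orbits n) (state_code t))) | \<pi> s l t. edge n z s l t}"
    by (simp add: automaton_of_def presentation_def set_all_edges Let_def) blast
  also have "\<dots> = {(sstate (perm_act \<pi> s), sletter (perm_act \<pi> l), sstate (perm_act \<pi> t)) | \<pi> s l t.
      edge n z s l t}"
  proof -
    have "(elem_act \<pi> (elem (state_orbits n) (state_code s)),
        elem_act \<pi> (elem (letter_orbits n) (letter_code l)),
        elem_act \<pi> (elem (state_orbits n) (state_code t))) =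
      (sstate (perm_act \<pi> s), sletter (perm_act \<pi> l), sstate (perm_act \<pi> t))"
      if "edge n z s l t" for \<pi> s l t
      using edge_wf[OF that]
      by (simp add: elem_state elem_letter elem_act_single perm_act_state_code perm_act_letter_code)
    then show ?thesis
      by (intro Collect_cong iff_exI) auto
  qed
  also have "\<dots> = {(sstate s, sletter l, sstate t) | s l t. tr n z s l t}"
    unfolding tr_def by blast
  finally show ?thesis .
qed

lemma transitions_aut_iff:
  "(sstate s, a, q) \<in> transitions (aut z) \<longleftrightarrow> (\<exists>l t. a = sletter l \<and> q = sstate t \<and> tr n z s l t)"
  unfolding transitions_aut mem_Collect_eq prod.inject inj_sstate by blast

lemma accepts_aut: "accepts (aut z) (sstate s) v \<longleftrightarrow> (\<exists>w. v = map sletter w \<and> acc n z s w)"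
proof (induction v arbitrary: s)
  case Nil
  then show ?case by (simp add: aut_simps inj_sstate)
next
  case (Cons a v)
  have "accepts (aut z) (sstate s) (a # v) \<longleftrightarrow>
      (\<exists>l t. a = sletter l \<and> tr n z s l t \<and> accepts (aut z) (sstate t) v)"
    unfolding accepts.simps transitions_aut_iff by blast
  also have "\<dots> \<longleftrightarrow> (\<exists>w. a # v = map sletter w \<and> acc n z s w)"
    unfolding Cons.IH Cons_eq_map_conv by (metis acc.simps(2))
  finally show ?case .
qed

lemma language_aut: "language (aut z) = map sletter ` {w. acc n z (Start, []) w}"
proof -
  have "transitions (aut z) \<subseteq> states (aut z) \<times> alphabet (aut z) \<times> states (aut z)"
    using nominal_automaton_of[OF wf_pres] by (simp add: nominal_automaton_def)
  then have "accepts (aut z) q v \<Longrightarrow> v \<in> lists (alphabet (aut z))" for q v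
    by (rule accepts_lists)
  then have "language (aut z) = {v. accepts (aut z) (sstate (Start, [])) v}"
    unfolding language_def state_language_def aut_simps(3) by blast
  also have "\<dots> = map sletter ` {w. acc n z (Start, []) w}"
    unfolding accepts_aut by blast
  finally show ?thesis .
qed

lemma language_eq_iff:
  "language (aut False) = language (aut True) \<longleftrightarrow> (\<forall>w\<in>lists (Is \<times> UNIV). rejected n w)"
proof -
  have "inj sletter" by (rule injI) (simp add: inj_sletter)
  then have "inj (map sletter)" by simp
  then have "language (aut False) = language (aut True) \<longleftrightarrow>
      {w. acc n False (Start, []) w} = {w. acc n True (Start, []) w}"
    unfolding language_aut by (rule inj_image_eq_iff)
  also have "\<dots> \<longleftrightarrow> (\<forall>w\<in>lists (Is \<times> UNIV). rejected n w)"
    unfolding acc_eq_iff[symmetric] by auto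
  finally show ?thesis .
qed

text \<open>The witness for a state is a one-letter word: the only transition from
  \<open>Start\<close> under an anchor letter leads to the node of the anchor, with the register, if
  any, set to the atom of the letter.\<close>

lemma residual_aut: "residual_automaton (aut z)"
  unfolding residual_automaton_def
proof (intro conjI ballI)
  show nominal: "nominal_automaton (aut z)" by (rule nominal_automaton_of[OF wf_pres])
  fix q assume "q \<in> states (aut z)"
  then obtain i t where it: "q = single (i, t)" "wf_elem (state_orbits n) (i, t)"
    by (auto simp: aut_simps carrier_of_def elem_state)
  obtain v where v: "node_index v = i" using ex_node_index by blast
  \<comment> \<open>For arity 0 any atom serves; for arity 1 it is the content of the
    register.\<close>
  obtain a where a: "t = replicate (arity v) a"
    using it(2) v by (auto simp: wf_elem_state arity_node_index length_Suc_conv split: if_splits)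
  have q: "q = sstate (v, t)" using it v by (simp add: state_code_def)
  have i: "node_index v \<le> 3 * n" using it(2) v by (simp add: wf_elem_state)
  let ?l = "(Anchor v, [a])"
  have "wf_elem (letter_orbits n) (letter_code ?l)"
    using i by (simp add: letter_code_def wf_elem_letter)
  then have l: "sletter ?l \<in> alphabet (aut z)"
    unfolding aut_simps carrier_of_def by (auto intro!: exI[of _ "letter_code ?l"] simp: elem_letter)
  have "accepts (aut z) (sstate (Start, [])) (sletter ?l # v') \<longleftrightarrow> accepts (aut z) q v'" for v'
    unfolding accepts.simps q transitions_aut_iff inj_sletter using tr_Start_Anchor[OF i] a by metis
  then have "state_language (aut z) q = {v'. [sletter ?l] @ v' \<in> language (aut z)}"
    using l by (auto simp: language_def state_language_def aut_simps)
  then show "\<exists>w\<in>lists (alphabet (aut z)). state_language (aut z) q = {v'. w @ v' \<in> language (aut z)}"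
    using l by (intro bexI[of _ "[sletter ?l]"]) auto
qed

end

section \<open>Computability of the reduction\<close>

definition computable :: "nat \<Rightarrow> (nat list \<Rightarrow> nat) \<Rightarrow> bool" where
  "computable k F \<longleftrightarrow> (\<exists>f. \<forall>xs. length xs = k \<longrightarrow> rec_eval f xs = Some (F xs))"

lemma computable_nth: "i < k \<Longrightarrow> computable k (\<lambda>xs. xs ! i)"
  unfolding computable_def by (intro exI[of _ "Proj i"]) simp

lemma computable_Suc: "computable k F \<Longrightarrow> computable k (\<lambda>xs. Suc (F xs))"
  unfolding computable_def by (elim exE, rule_tac x = "Comp Succ [f]" in exI) simp

lemma computable_const: "computable k (\<lambda>xs. c)"
proof (induction c)
  case 0
  show ?case unfolding computable_def by (intro exI[of _ Zero]) simp
qed (rule computable_Suc)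

lemma those_map_Some: "those (map (\<lambda>x. Some (f x)) xs) = Some (map f xs)"
  by (induction xs) auto

lemma computable_rec:
  assumes "computable k F" "computable k B" "computable (Suc (Suc k)) G"
  shows "computable k (\<lambda>xs. rec_nat (B xs) (\<lambda>m r. G (m # r # xs)) (F xs))"
proof -
  obtain f b g where f: "\<And>xs. length xs = k \<Longrightarrow> rec_eval f xs = Some (F xs)"
    and b: "\<And>xs. length xs = k \<Longrightarrow> rec_eval b xs = Some (B xs)"
    and g: "\<And>xs. length xs = Suc (Suc k) \<Longrightarrow> rec_eval g xs = Some (G xs)"
    using assms unfolding computable_def by blast
  \<comment> \<open>\<open>f\<close> supplies the recursion argument, and the projections pass on
    the original arguments.\<close>
  have "rec_eval (Comp (PrimRec b g) (f # map Proj [0..<k])) xs =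
      Some (rec_nat (B xs) (\<lambda>m r. G (m # r # xs)) (F xs))" if len: "length xs = k" for xs
  proof -
    have "map (\<lambda>g. rec_eval g xs) (map Proj [0..<k]) = map (\<lambda>i. Some (xs ! i)) [0..<k]"
      using len by simp
    then have "those (map (\<lambda>g. rec_eval g xs) (map Proj [0..<k])) = Some xs"
      using len map_nth[of xs] by (simp only: those_map_Some)
    moreover have "rec_nat (rec_eval b xs) (\<lambda>m r. Option.bind r (\<lambda>y. rec_eval g (m # y # xs))) n =
        Some (rec_nat (B xs) (\<lambda>m r. G (m # r # xs)) n)" for n
      using len by (induction n) (simp_all add: b g)
    ultimately show ?thesis using len by (simp add: f del: map_map)
  qed
  then show ?thesis unfolding computable_def by blast
qed

lemma computable_add:
  assumes "computable k F" "computable k G"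
  shows "computable k (\<lambda>xs. F xs + G xs)"
proof -
  have "rec_nat y (\<lambda>m r. Suc ((m # r # xs) ! 1)) x = x + y" for x y :: nat and xs
    by (induction x) auto
  then show ?thesis
    using computable_rec[OF assms computable_Suc[OF computable_nth[of 1]]] by simp
qed

lemma computable_cmult: "computable k F \<Longrightarrow> computable k (\<lambda>xs. c * F xs)"
  by (induction c) (simp_all add: computable_const computable_add)

lemma computable_triangle:
  assumes "computable k F"
  shows "computable k (\<lambda>xs. triangle (F xs))"
proof -
  have rec: "rec_nat 0 (\<lambda>m r. (m # r # xs) ! 1 + Suc ((m # r # xs) ! 0)) x = triangle x" for x :: nat and xs
    by (induction x) auto
  have "computable (Suc (Suc k)) (\<lambda>xs. xs ! 1 + Suc (xs ! 0))"
    by (intro computable_add computable_Suc computable_nth) auto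
  from computable_rec[OF assms computable_const[of k 0] this] show ?thesis
    by (simp only: rec)
qed

lemma computable_prod_encode:
  "computable k F \<Longrightarrow> computable k G \<Longrightarrow> computable k (\<lambda>xs. prod_encode (F xs, G xs))"
  unfolding prod_encode_def prod.case by (intro computable_add computable_triangle)

lemma computable_encode_elem: "computable k F \<Longrightarrow> computable k (\<lambda>xs. encode_elem (F xs, t))"
  unfolding encode_elem_def by (simp add: computable_prod_encode computable_const)

lemma computable_encode_transition:
  assumes "computable k F" "computable k G" "computable k H"
  shows "computable k (\<lambda>xs. encode_transition ((F xs, s), (G xs, t), (H xs, u)))"
  unfolding encode_transition_def using assms
  by (auto intro!: computable_Suc computable_prod_encode computable_encode_elem computable_const)

lemmas computable_intros =
  computable_encode_transition computable_prod_encode computable_cmult computable_add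
  computable_Suc computable_const computable_nth

definition cons_code :: "nat \<Rightarrow> nat \<Rightarrow> nat" where
  "cons_code x r = Suc (prod_encode (x, r))"

lemma list_encode_Cons: "list_encode (x # xs) = cons_code x (list_encode xs)"
  by (simp add: cons_code_def)

lemma computable_cons_code:
  "computable k F \<Longrightarrow> computable k G \<Longrightarrow> computable k (\<lambda>xs. cons_code (F xs) (G xs))"
  unfolding cons_code_def by (intro computable_intros)

definition orbit_code :: "orbit_pres \<Rightarrow> nat" where
  "orbit_code = (\<lambda>(k, G). prod_encode (k, list_encode (map list_encode G)))"

lemma encode_set_alt: "encode_set X = list_encode (map orbit_code X)"
  by (simp add: encode_set_def orbit_code_def)

abbreviation transitions_code where
  "transitions_code T \<equiv> list_encode (map encode_transition T)"

lemma computable_state_orbits: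
  assumes "computable k F"
  shows "computable k (\<lambda>xs. encode_set (state_orbits (F xs)))"
proof -
  let ?G = "\<lambda>xs. cons_code (orbit_code (0, [[]])) (cons_code (orbit_code (1, [[0]]))
    (cons_code (orbit_code (0, [[]])) (xs ! 1)))"
  have rec: "rec_nat (encode_set (state_orbits 0)) (\<lambda>m r. ?G (m # r # xs)) n = encode_set (state_orbits n)"
    for n xs
    by (induction n) (simp_all add: encode_set_alt list_encode_Cons del: list_encode.simps(2))
  have "computable (Suc (Suc k)) ?G"
    by (intro computable_cons_code computable_const computable_nth) simp
  from computable_rec[OF assms computable_const[of k "encode_set (state_orbits 0)"] this]
  show ?thesis by (simp only: rec)
qed

lemma computable_letter_orbits:
  assumes "computable k F"
  shows "computable k (\<lambda>xs. encode_set (letter_orbits (F xs)))"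
proof -
  let ?G = "\<lambda>xs. cons_code (orbit_code (1, [[0]])) (xs ! 1)"
  have rec: "rec_nat 0 (\<lambda>m r. ?G (m # r # xs)) n = encode_set (replicate n (1, [[0]]))" for n xs
    by (induction n) (simp_all add: encode_set_alt list_encode_Cons del: list_encode.simps(2))
  have "computable (Suc (Suc k)) ?G" "computable k (\<lambda>xs. Suc (6 * F xs))"
    by (intro computable_cons_code computable_intros assms; simp)+
  from computable_rec[OF this(2) computable_const[of k 0] this(1)] show ?thesis
    by (simp only: rec letter_orbits_def)
qed

text \<open>The recursion prepends blocks to a given code, so \<open>T\<close> enters through its
  code only and is never decoded.\<close>

lemma computable_add_blocks:
  assumes "computable k F" "computable k B"
  shows "\<exists>G. computable k G \<and>
    (\<forall>xs T. length xs = k \<longrightarrow> B xs = transitions_code T \<longrightarrow> G xs = transitions_code (add_blocks (F xs) T))"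
proof -
  let ?G = "\<lambda>xs. 
    cons_code (encode_transition ((2, []), (2 * (3 * xs ! 0), [0]), (3 * xs ! 0, [])))
   (cons_code (encode_transition ((2, []), (2 * (3 * xs ! 0 + 1), [0]), (3 * xs ! 0 + 1, [0])))
   (cons_code (encode_transition ((2, []), (2 * (3 * xs ! 0 + 2), [0]), (3 * xs ! 0 + 2, [])))
   (cons_code (encode_transition ((3 * xs ! 0, []), (5, [0]), (3 * xs ! 0 + 3, [])))
   (cons_code (encode_transition ((3 * xs ! 0, []), (15, [0]), (5, []))) (xs ! 1)))))"
  have rec: "rec_nat (transitions_code T) (\<lambda>m r. ?G (m # r # xs)) n = transitions_code (add_blocks n T)"
    for n xs T
    by (induction n) (simp_all add: anchor_def list_encode_Cons del: list_encode.simps(2))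
  have "computable (Suc (Suc k)) ?G"
    by (intro computable_cons_code computable_intros) simp_all
  let ?R = "\<lambda>xs. rec_nat (B xs) (\<lambda>m r. ?G (m # r # xs)) (F xs)"
  have "computable k ?R"
    by (rule computable_rec[OF assms \<open>computable (Suc (Suc k)) ?G\<close>])
  moreover have "?R xs = transitions_code (add_blocks (F xs) T)" if "B xs = transitions_code T" for xs T
    unfolding that by (rule rec)
  ultimately show ?thesis by blast
qed

text \<open>The argument \<open>n\<close> is used twice: as the number of blocks and as the code of
  \<open>T\<close>.\<close>

lemma computable_all_edges:
  "\<exists>G. computable 1 G \<and> (\<forall>T n. n = transitions_code T \<longrightarrow> G [n] = transitions_code (all_edges n z T))"
proof -
  obtain B where B: "computable 1 B"
    "\<And>n T. n = transitions_code T \<Longrightarrow> B [n] = transitions_code (add_blocks n T)"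
    using computable_add_blocks[of 1 "\<lambda>xs. xs ! 0" "\<lambda>xs. xs ! 0"] computable_nth[of 0 1] by auto
  let ?G = "\<lambda>xs. 
    cons_code (encode_transition ((3 * xs ! 0, []), (5, [0]), (5, [])))
   (cons_code (encode_transition ((2, []), (2 * (3 * xs ! 0), [0]), (3 * xs ! 0, []))) (B xs))"
  let ?H = "\<lambda>xs. if z then cons_code (encode_transition ((2, []), (1, [0]), (5, []))) (?G xs) else ?G xs"
  have G: "computable 1 ?G"
    by (intro computable_cons_code computable_intros B) simp_all
  then have "computable 1 ?H"
    by (cases z) (auto intro: computable_cons_code computable_const)
  moreover have "?H [n] = transitions_code (all_edges n z T)" if "n = transitions_code T" for n T
    using B(2)[OF that]
    by (simp add: all_edges_def anchor_def list_encode_Cons del: list_encode.simps(2))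
  ultimately show ?thesis by blast
qed

lemma computable_encode_automaton:
  "\<exists>G. computable 1 G \<and>
    (\<forall>T n. n = transitions_code T \<longrightarrow> G [n] = encode_automaton (presentation n z T))"
proof -
  obtain E where E: "computable 1 E"
    "\<And>n T. n = transitions_code T \<Longrightarrow> E [n] = transitions_code (all_edges n z T)"
    using computable_all_edges[of z] by auto
  let ?G = "\<lambda>xs. cons_code (encode_set (letter_orbits (xs ! 0))) (cons_code (encode_set (state_orbits (xs ! 0)))
    (cons_code (list_encode [encode_elem (2, [])]) (cons_code (list_encode [encode_elem (8, [])])
    (cons_code (E xs) 0))))"
  have "computable 1 (\<lambda>xs. encode_set (letter_orbits (xs ! 0)))"
    "computable 1 (\<lambda>xs. encode_set (state_orbits (xs ! 0)))"
    using computable_letter_orbits computable_state_orbits computable_nth[of 0 1] by auto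
  then have "computable 1 ?G"
    using E(1) by (intro computable_cons_code computable_const)
  moreover have "?G [n] = encode_automaton (presentation n z T)" if "n = transitions_code T" for n T
    using E(2)[OF that]
    by (simp add: encode_automaton_def presentation_def cons_code_def)
  ultimately show ?thesis by blast
qed

lemma computable_encode_input:
  "\<exists>G. computable 1 G \<and> (\<forall>T n. n = transitions_code T \<longrightarrow>
     G [n] = encode_input (presentation n False T, presentation n True T))"
proof -
  obtain E where E: "\<And>z. computable 1 (E z)"
    "\<And>z n T. n = transitions_code T \<Longrightarrow> E z [n] = encode_automaton (presentation n z T)"
    using computable_encode_automaton by metis
  have "computable 1 (\<lambda>xs. prod_encode (E False xs, E True xs))"
    by (intro computable_prod_encode E)
  moreover have "prod_encode (E False [n], E True [n]) =
      encode_input (presentation n False T, presentation n True T)" if "n = transitions_code T" for n T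
    using E(2)[OF that] by (simp add: encode_input_def)
  ultimately show ?thesis by blast
qed

lemma less_list_encode: "x \<in> set xs \<Longrightarrow> x < list_encode xs"
proof (induction xs)
  case (Cons y ys)
  then show ?case
    using le_prod_encode_1[of y "list_encode ys"] le_prod_encode_2[of "list_encode ys" y] by auto
qed simp

text \<open>Pairing codes bound their components and list codes exceed their entries. This provides
  \<open>T_less\<close> when \<open>n\<close> is the code of \<open>T\<close>.\<close>

lemma transitions_code_bound:
  assumes "(p, a, q) \<in> set T"
  shows "fst p < transitions_code T \<and> fst a < transitions_code T \<and> fst q < transitions_code T"
proof -
  have elem: "fst e \<le> encode_elem e" for e
    by (cases e) (simp add: encode_elem_def le_prod_encode_1)
  have "encode_transition (p, a, q) < transitions_code T"
    using assms by (intro less_list_encode) auto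
  moreover have "encode_elem e < encode_transition (p, a, q)" if "e \<in> {p, a, q}" for e
    unfolding encode_transition_def prod.case using that by (intro less_list_encode) auto
  ultimately have "fst e < transitions_code T" if "e \<in> {p, a, q}" for e
    using elem[of e] that by fastforce
  then show ?thesis by simp
qed

text \<open>\<open>d\<close> is an unbounded search for a zero of a function that ignores the search
  variable: it stops at once if \<open>f\<close> answers 1 on \<open>G [n]\<close>, and never if
  \<open>f\<close> answers 0.\<close>

lemma halts_iff_flag:
  assumes "computable 1 G"
  shows "\<exists>d. \<forall>n b. rec_eval f [G [n]] = Some (if b then 1 else 0) \<longrightarrow> (rec_eval d [n] \<noteq> None \<longleftrightarrow> b)"
proof -
  obtain g where g: "\<And>n. rec_eval g [n] = Some (G [n])"
    using assms unfolding computable_def by force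
  define is_zero where "is_zero = PrimRec (Comp Succ [Zero]) Zero"
  define body where "body = Comp is_zero [Comp f [Comp g [Proj 1]]]"
  have is_zero: "rec_eval is_zero [x] = Some (if x = 0 then 1 else 0)" for x
    by (induction x) (simp_all add: is_zero_def)
  have body: "rec_eval body [m, n] = Some (if b then 0 else 1)"
    if "rec_eval f [G [n]] = Some (if b then 1 else 0)" for m n b
    using that by (simp add: body_def g is_zero)
  have "rec_eval (Mu body) [n] \<noteq> None \<longleftrightarrow> b"
    if "rec_eval f [G [n]] = Some (if b then 1 else 0)" for n b
    using body[OF that] by (auto simp: Let_def split: if_splits)
  then show ?thesis by blast
qed

section \<open>Undecidability\<close>

lemma (in gadget) finite_template: "finite {(s, l, t). template s l t}"
proof -
  let ?N = "{Start, Accept, End, Chain 0} \<union> Control ` h ` quot \<union> (\<lambda>(b, c). Member b c) ` (UNIV \<times> {..<K})"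
  let ?S = "?N \<times> {[], [0], [1 :: atom]}"
  let ?L = "({Hash, Dollar} \<union> Instr ` Is) \<times> {[0], [1 :: atom]}"
  have "s \<in> ?S \<and> l \<in> ?L \<and> t \<in> ?S" if "template s l t" for s l t
    using that by (induction rule: template.induct) (auto simp: L_quot lquot_quot le_Suc_eq)
  then have "{(s, l, t). template s l t} \<subseteq> ?S \<times> ?L \<times> ?S"
    by blast
  moreover have "finite (?S \<times> ?L \<times> ?S)"
    using finite_Is finite_quot by (simp add: quot_def)
  ultimately show ?thesis by (rule finite_subset)
qed

text \<open>The templates do not mention \<open>n\<close>. So \<open>T\<close> can be listed first
  and its code be taken as the number of blocks afterwards, without circularity.\<close>

lemma ex_coded_gadget:
  assumes "regular R"
  shows "\<exists>Is h K T. coded_gadget Is (input_words R) h K T (transitions_code T)"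
proof -
  let ?L = "input_words R"
  have L: "finite (range (\<lambda>w. lquot w ?L))" "\<exists>A. finite A \<and> ?L \<subseteq> lists A"
    using regular_input_words[OF assms] by (auto simp: regular_def)
  from L(2) obtain A where A: "finite A" "?L \<subseteq> lists A" by blast
  obtain h :: "instr list set \<Rightarrow> nat" where h: "inj_on h (range (\<lambda>w. lquot w ?L))"
    using finite_imp_inj_to_nat_seg[OF L(1)] by blast
  \<comment> \<open>The two input instructions are added explicitly, since \<open>A\<close> may lack
    them when \<open>R\<close> is empty.\<close>
  define Is where "Is = A \<union> {Inc 0, Tst 1}"
  define K where "K = Suc (Max (counter ` Is))"
  have "finite Is" using A(1) by (simp add: Is_def)
  interpret gadget Is ?L h K
  proof
    show "counter i < K" if "i \<in> Is" for i
      unfolding K_def using that \<open>finite Is\<close> by (simp add: le_imp_less_Suc)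
    show "?L \<subseteq> lists Is"
      using A(2) lists_mono[of A Is] unfolding Is_def by blast
  qed (use \<open>finite Is\<close> L(1) h in \<open>auto simp: Is_def\<close>)
  have "{(state_code s, letter_code l, state_code t) | s l t. template s l t} =
      (\<lambda>(s, l, t). (state_code s, letter_code l, state_code t)) ` {(s, l, t). template s l t}"
    by force
  then obtain T where
    T: "set T = {(state_code s, letter_code l, state_code t) | s l t. template s l t}"
    using finite_list[OF finite_imageI[OF finite_template]] by metis
  have "coded_gadget Is ?L h K T (transitions_code T)"
    by unfold_locales (use T transitions_code_bound in auto)
  then show ?thesis by blast
qed

theorem proposition5p3:
  shows "\<not> decidable_under_promise encode_input
           {(P1, P2). wf_pres P1 \<and> wf_pres P2 \<and> alphabet_pres P1 = alphabet_pres P2 \<and>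
              residual_automaton (automaton_of P1) \<and> residual_automaton (automaton_of P2)}
           {(P1, P2). language (automaton_of P1) = language (automaton_of P2)}"
    (is "\<not> decidable_under_promise _ ?D ?Y")
proof
  assume "decidable_under_promise encode_input ?D ?Y"
  then obtain f where f: "\<And>x. x \<in> ?D \<Longrightarrow> rec_eval f [encode_input x] = Some (if x \<in> ?Y then 1 else 0)"
    unfolding decidable_under_promise_def by blast
  obtain G where G: "computable 1 G"
    "\<And>T n. n = transitions_code T \<Longrightarrow>
       G [n] = encode_input (presentation n False T, presentation n True T)"
    using computable_encode_input by auto
  \<comment> \<open>\<open>d\<close> halts on \<open>n\<close> iff \<open>f\<close> affirms
    equivalence for the pair computed from \<open>n\<close>.\<close>
  obtain d where d: "\<And>n b. rec_eval f [G [n]] = Some (if b then 1 else 0) \<Longrightarrow>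
      rec_eval d [n] \<noteq> None \<longleftrightarrow> b"
    using halts_iff_flag[OF G(1)] by blast
  \<comment> \<open>The input is passed in register 0, and scratch space begins at register
    1.\<close>
  obtain F where F: "implements F d [0] 1"
    using ex_implements[of "[0]" 1 d] by auto
  then obtain R where R: "regular R" "sem R = F"
    unfolding implements_def programmable_def by blast
  obtain Is h K T where gadget: "coded_gadget Is (input_words R) h K T (transitions_code T)"
    using ex_coded_gadget[OF R(1)] by blast
  \<comment> \<open>the diagonal: the program for \<open>d\<close> is run on the code of its own transitions\<close>
  define n where "n = transitions_code T"
  interpret coded_gadget Is "input_words R" h K T n
    using gadget unfolding n_def .
  let ?x = "(pres False, pres True)"
  have "?x \<in> ?D"
    using wf_pres residual_aut by (simp add: presentation_def)
  then have "rec_eval f [G [n]] = Some (if ?x \<in> ?Y then 1 else 0)"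
    using f[of ?x] G(2)[OF n_def] by simp
  then have "rec_eval d [n] \<noteq> None \<longleftrightarrow> ?x \<in> ?Y" by (rule d)
  \<comment> \<open>The languages agree iff all instruction words are rejected, that is, iff the
    program for \<open>d\<close> has no execution on \<open>n\<close>.\<close>
  also have "\<dots> \<longleftrightarrow> sem R ((\<lambda>c. 0)(0 := n)) = {}"
    using language_eq_iff all_rejected_iff[OF refl] by simp
  \<comment> \<open>All registers from 1 on are zero, so the program yields no store iff
    \<open>d\<close> diverges on \<open>n\<close>. Thus \<open>d\<close> would halt on
    \<open>n\<close> iff it diverges there.\<close>
  also have "\<dots> \<longleftrightarrow> rec_eval d [n] = None"
    unfolding R(2) using implementsD[OF F, of "(\<lambda>c. 0)(0 := n)" "[n]"] by (simp split: option.splits)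
  finally show False by blast
qed

end
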